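(* Work in a $\lambda\mu$-theory (defined in the context). Let $\mathcal{F}$ be a focus functor and let $\mathcal{G}$ be a functor such that there exists a natural isomorphism $\varphi_\alpha : \neg\mathcal{G}\alpha \cong \mathcal{F}(\neg\alpha)$ (natural in the type $\alpha$). Let $C = \nu\alpha.\mathcal{G}\alpha$ be a type with a function $X : C \to \mathcal{G}C$ which is a final $\mathcal{G}$-coalgebra. If $X$ is focal, then the composite $$\mathcal{F}(\neg C) \xrightarrow{\ \varphi_C^{-1}\ } \neg\mathcal{G}C \xrightarrow{\ \neg X\ } \neg C$$ is a focally initial $\mathcal{F}$-algebra.
   Context: The call-by-name $\lambda\mu$-calculus. Types: $A ::= \tau \mid A\to A \mid \top \mid A\times A \mid \bot \mid A\lor A$ ($\tau$ ranges over type constants). Terms: $M ::= c \mid x \mid \lambda x^A.M \mid MM \mid \langle\rangle \mid \langle M,M\rangle \mid \pi_1 M \mid \pi_2 M \mid \mu a^A.M \mid aM \mid \mu(a^A,a^A).M \mid [a,a]M$, where $c$ ranges over constants, $x$ over variables and $a$ over control variables. Judgments have the form $x_1:B_1,\dots,x_n:B_n \vdash M : A \mid a_1:A_1,\dots,a_m:A_m$, with the usual typing rules of the simply typed $\lambda$-calculus with products and terminal type $\top$, plus: from $\Gamma\vdash M:\bot\mid a:A,\Delta$ infer $\Gamma\vdash \mu a^A.M : A\mid\Delta$; from $\Gamma\vdash M:A\mid a:A,\Delta$ infer $\Gamma\vdash aM:\bot\mid a:A,\Delta$; from $\Gamma\vdash M:\bot\mid a_1:A_1,a_2:A_2,\Delta$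 infer $\Gamma\vdash\mu(a_1,a_2).M : A_1\lor A_2\mid\Delta$; from $\Gamma\vdash M:A_1\lor A_2\mid a_1:A_1,a_2:A_2,\Delta$ infer $\Gamma\vdash [a_1,a_2]M:\bot\mid a_1:A_1,a_2:A_2,\Delta$. The equality is the least congruence on well-typed terms containing: $(\lambda x.M)N = M[x:=N]$; $\lambda x.Mx = M$ ($x\notin FV(M)$); $\pi_j\langle M_1,M_2\rangle = M_j$; $\langle\pi_1M,\pi_2M\rangle = M$; $\langle\rangle = M$ (for $M:\top$); $b(\mu a.M) = M[a:=b]$; $\mu a.aM = M$ ($a\notin FV(M)$); $[b_1,b_2](\mu(a_1,a_2).M) = M[a_1,a_2:=b_1,b_2]$; $\mu(a_1,a_2).[a_1,a_2]M = M$ ($a_1,a_2\notin FV(M)$); $b M = M$ when $b$ has type $\bot$; $(\mu a.M)N = \mu b.M[a\square:=b(\square N)]$; $\pi_j(\mu a.M) = \mu b.M[a\square := b(\pi_j\square)]$; $[a_1,a_2](\mu a.M) = M[a\square:=[a_1,a_2]\square]$ (with $b$ fresh). Here $M[a\square:=C]$ recursively replaces each subterm $aN$ by $C[N[a\square:=C]]$ and each $[a_1,a_2]N$ with $a\in\{a_1,a_2\}$ by $C[\mu a.[a_1,a_2]N[a\square:=C]]$. A $\lambda\mu$-theory is an equational extension of this calculus (possibly with additional type constants, constants and equations); it is viewed as a category whose objects are types and whose morphisms $B\to A$ are terms of type $B\to A$ modulo equality, with the usual composition. Notation: $\neg A := A\to\bot$; for $F : B\to A$, $\neg F := \lambda k^{\neg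 A}.\lambda x^B.k(Fx) : \neg A\to\neg B$. A term $F:B\to A$ is focal if $F(\mu a.M) = \mu b.M[a\square := b(F\square)]$ for every term $M$ and fresh control variable $b$. A functor is an endofunctor on the theory (a map on types and on functions preserving identities and composition) which moreover sends focal functions to focal functions; a focus functor is such a map defined only on types and focal functions (sending focal functions to focal functions and preserving identities and composition). A final $\mathcal{G}$-coalgebra is a type $C$ with $X:C\to\mathcal{G}C$ such that for every function $F:A\to\mathcal{G}A$ there is a unique function $H:A\to C$ with $X\circ H = \mathcal{G}H\circ F$. For a focus functor $\mathcal{F}$, a focally initial $\mathcal{F}$-algebra is a type $C$ with a focal function $X:\mathcal{F}C\to C$ such that for every focal function $F:\mathcal{F}A\to A$ there exists a focal function $H:C\to A$ with $H\circ X = F\circ\mathcal{F}H$, and $H$ is unique among focal functions with this property.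
   Formalization: The natural isomorphism φ is additionally required to have focal components (an isomorphism in the category of focal functions); otherwise the composite need not be focal, e.g. F = const ⊥, G = const ⊤, with φ twisted by a non-identity involution of ⊥. *)

theory Defs
  imports Main
begin

text \<open>
  Terms are represented by de Bruijn indices, with two separate index spaces: one for variables
  (bound by \<open>Lam\<close>) and one for control variables (bound by \<open>Mu\<close> and \<open>Mu2\<close>). Hence terms are
  literally identified up to renaming of bound variables, and freshness side conditions become
  shifts. A judgment has a list \<open>\<Gamma>\<close> of types for the variables and a list \<open>\<Delta>\<close> of types for the
  control variables.
\<close>

datatype 't ty =
    Base 't
  | Arr "'t ty" "'t ty"  (infixr "\<^bold>\<rightarrow>" 65)
  | Top
  | Times "'t ty" "'t ty"
  | Bot
  | Or "'t ty" "'t ty"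

abbreviation Neg :: "'t ty \<Rightarrow> 't ty" where
  "Neg A \<equiv> A \<^bold>\<rightarrow> Bot"

text \<open>
  \<open>Name a M\<close> is \<open>a M\<close> and \<open>Name2 a b M\<close> is \<open>[a, b] M\<close>. \<open>Mu2 A B M\<close> is \<open>\<mu>(a\<^sup>A, b\<^sup>B). M\<close>, where
  \<open>a\<close> has index 0 and \<open>b\<close> has index 1 in \<open>M\<close>.
\<close>

datatype ('t, 'c) trm =
    Const 'c
  | Var nat
  | Lam "'t ty" "('t, 'c) trm"
  | App "('t, 'c) trm" "('t, 'c) trm"
  | Unit
  | Pair "('t, 'c) trm" "('t, 'c) trm"
  | Proj1 "('t, 'c) trm"
  | Proj2 "('t, 'c) trm"
  | Mu "'t ty" "('t, 'c) trm"
  | Name nat "('t, 'c) trm"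
  | Mu2 "'t ty" "'t ty" "('t, 'c) trm"
  | Name2 nat nat "('t, 'c) trm"

definition up :: "(nat \<Rightarrow> nat) \<Rightarrow> nat \<Rightarrow> nat" where
  "up f = case_nat 0 (\<lambda>n. Suc (f n))"

text \<open>Renaming of variables (\<open>renv\<close>) and of control variables (\<open>renc\<close>).\<close>

primrec renv :: "(nat \<Rightarrow> nat) \<Rightarrow> ('t, 'c) trm \<Rightarrow> ('t, 'c) trm" where
  "renv f (Const c) = Const c"
| "renv f (Var n) = Var (f n)"
| "renv f (Lam A M) = Lam A (renv (up f) M)"
| "renv f (App M N) = App (renv f M) (renv f N)"
| "renv f Unit = Unit"
| "renv f (Pair M N) = Pair (renv f M) (renv f N)"
| "renv f (Proj1 M) = Proj1 (renv f M)"
| "renv f (Proj2 M) = Proj2 (renv f M)"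
| "renv f (Mu A M) = Mu A (renv f M)"
| "renv f (Name a M) = Name a (renv f M)"
| "renv f (Mu2 A B M) = Mu2 A B (renv f M)"
| "renv f (Name2 a b M) = Name2 a b (renv f M)"

primrec renc :: "(nat \<Rightarrow> nat) \<Rightarrow> ('t, 'c) trm \<Rightarrow> ('t, 'c) trm" where
  "renc g (Const c) = Const c"
| "renc g (Var n) = Var n"
| "renc g (Lam A M) = Lam A (renc g M)"
| "renc g (App M N) = App (renc g M) (renc g N)"
| "renc g Unit = Unit"
| "renc g (Pair M N) = Pair (renc g M) (renc g N)"
| "renc g (Proj1 M) = Proj1 (renc g M)"
| "renc g (Proj2 M) = Proj2 (renc g M)"
| "renc g (Mu A M) = Mu A (renc (up g) M)"
| "renc g (Name a M) = Name (g a) (renc g M)"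
| "renc g (Mu2 A B M) = Mu2 A B (renc (up (up g)) M)"
| "renc g (Name2 a b M) = Name2 (g a) (g b) (renc g M)"

primrec subst :: "(nat \<Rightarrow> ('t, 'c) trm) \<Rightarrow> ('t, 'c) trm \<Rightarrow> ('t, 'c) trm" where
  "subst s (Const c) = Const c"
| "subst s (Var n) = s n"
| "subst s (Lam A M) = Lam A (subst (case_nat (Var 0) (\<lambda>n. renv Suc (s n))) M)"
| "subst s (App M N) = App (subst s M) (subst s N)"
| "subst s Unit = Unit"
| "subst s (Pair M N) = Pair (subst s M) (subst s N)"
| "subst s (Proj1 M) = Proj1 (subst s M)"
| "subst s (Proj2 M) = Proj2 (subst s M)"
| "subst s (Mu A M) = Mu A (subst (\<lambda>n. renc Suc (s n)) M)"
| "subst s (Name a M) = Name a (subst s M)"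
| "subst s (Mu2 A B M) = Mu2 A B (subst (\<lambda>n. renc (\<lambda>i. Suc (Suc i)) (s n)) M)"
| "subst s (Name2 a b M) = Name2 a b (subst s M)"

text \<open>\<open>inst M N\<close> is \<open>M[x := N]\<close>, where \<open>x\<close> is the variable with index 0 in \<open>M\<close>.\<close>

definition inst :: "('t, 'c) trm \<Rightarrow> ('t, 'c) trm \<Rightarrow> ('t, 'c) trm" where
  "inst M N = subst (case_nat N Var) M"

text \<open>
  \<open>ssub A a C M\<close> is the structural substitution \<open>M[a\<box> := C]\<close> for a control variable \<open>a\<close> of
  type \<open>A\<close>. The hole of \<open>C\<close> is its variable with index 0, so that \<open>C[N]\<close> is \<open>inst C N\<close>, and the
  other variables of \<open>C\<close> are shifted accordingly. As \<open>a\<close> itself is replaced everywhere, the index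
  \<open>a\<close> becomes free for reuse: an occurrence of \<open>a\<close> in \<open>C\<close> stands for a new control variable, which
  takes over the place of the old one.
\<close>

primrec ssub :: "'t ty \<Rightarrow> nat \<Rightarrow> ('t, 'c) trm \<Rightarrow> ('t, 'c) trm \<Rightarrow> ('t, 'c) trm" where
  "ssub A a C (Const c) = Const c"
| "ssub A a C (Var n) = Var n"
| "ssub A a C (Lam B M) = Lam B (ssub A a (renv (up Suc) C) M)"
| "ssub A a C (App M N) = App (ssub A a C M) (ssub A a C N)"
| "ssub A a C Unit = Unit"
| "ssub A a C (Pair M N) = Pair (ssub A a C M) (ssub A a C N)"
| "ssub A a C (Proj1 M) = Proj1 (ssub A a C M)"
| "ssub A a C (Proj2 M) = Proj2 (ssub A a C M)"
| "ssub A a C (Mu B M) = Mu B (ssub A (Suc a) (renc Suc C) M)"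
| "ssub A a C (Name b M) =
     (if b = a then inst C (ssub A a C M) else Name b (ssub A a C M))"
| "ssub A a C (Mu2 B1 B2 M) =
     Mu2 B1 B2 (ssub A (Suc (Suc a)) (renc (\<lambda>i. Suc (Suc i)) C) M)"
| "ssub A a C (Name2 b1 b2 M) =
     (if b1 = a \<or> b2 = a
      then inst C (Mu A (Name2 (if b1 = a then 0 else Suc b1) (if b2 = a then 0 else Suc b2)
                          (renc Suc (ssub A a C M))))
      else Name2 b1 b2 (ssub A a C M))"

text \<open>
  A theory is given by its type constants (the type \<open>'t\<close>), its constants together with their types
  (\<open>csig\<close>; elements of \<open>'c\<close> outside the domain of \<open>csig\<close> are not constants of the theory), and its
  additional equations \<open>(\<Gamma>, M, N, A, \<Delta>)\<close>, read \<open>\<Gamma> \<turnstile> M = N : A | \<Delta>\<close>.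
\<close>

record ('t, 'c) lmtheory =
  csig :: "'c \<Rightarrow> 't ty option"
  eqns :: "('t ty list \<times> ('t, 'c) trm \<times> ('t, 'c) trm \<times> 't ty \<times> 't ty list) set"

inductive typed ::
  "('t, 'c) lmtheory \<Rightarrow> 't ty list \<Rightarrow> ('t, 'c) trm \<Rightarrow> 't ty \<Rightarrow> 't ty list \<Rightarrow> bool"
  ("_ \<rhd> _ \<turnstile> _ \<Colon> _ \<parallel> _" [51, 51, 51, 51, 51] 50)
  for T where
  typed_Const: "csig T c = Some A \<Longrightarrow> T \<rhd> \<Gamma> \<turnstile> Const c \<Colon> A \<parallel> \<Delta>"
| typed_Var: "n < length \<Gamma> \<Longrightarrow> T \<rhd> \<Gamma> \<turnstile> Var n \<Colon> \<Gamma> ! n \<parallel> \<Delta>"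
| typed_Lam: "T \<rhd> B # \<Gamma> \<turnstile> M \<Colon> A \<parallel> \<Delta> \<Longrightarrow> T \<rhd> \<Gamma> \<turnstile> Lam B M \<Colon> B \<^bold>\<rightarrow> A \<parallel> \<Delta>"
| typed_App: "T \<rhd> \<Gamma> \<turnstile> M \<Colon> B \<^bold>\<rightarrow> A \<parallel> \<Delta> \<Longrightarrow> T \<rhd> \<Gamma> \<turnstile> N \<Colon> B \<parallel> \<Delta> \<Longrightarrow> T \<rhd> \<Gamma> \<turnstile> App M N \<Colon> A \<parallel> \<Delta>"
| typed_Unit: "T \<rhd> \<Gamma> \<turnstile> Unit \<Colon> Top \<parallel> \<Delta>"
| typed_Pair: "T \<rhd> \<Gamma> \<turnstile> M \<Colon> A \<parallel> \<Delta> \<Longrightarrow> T \<rhd> \<Gamma> \<turnstile> N \<Colon> B \<parallel> \<Delta> \<Longrightarrow> T \<rhd> \<Gamma> \<turnstile> Pair M N \<Colon> Times A B \<parallel> \<Delta>"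
| typed_Proj1: "T \<rhd> \<Gamma> \<turnstile> M \<Colon> Times A B \<parallel> \<Delta> \<Longrightarrow> T \<rhd> \<Gamma> \<turnstile> Proj1 M \<Colon> A \<parallel> \<Delta>"
| typed_Proj2: "T \<rhd> \<Gamma> \<turnstile> M \<Colon> Times A B \<parallel> \<Delta> \<Longrightarrow> T \<rhd> \<Gamma> \<turnstile> Proj2 M \<Colon> B \<parallel> \<Delta>"
| typed_Mu: "T \<rhd> \<Gamma> \<turnstile> M \<Colon> Bot \<parallel> A # \<Delta> \<Longrightarrow> T \<rhd> \<Gamma> \<turnstile> Mu A M \<Colon> A \<parallel> \<Delta>"
| typed_Name: "a < length \<Delta> \<Longrightarrow> T \<rhd> \<Gamma> \<turnstile> M \<Colon> \<Delta> ! a \<parallel> \<Delta> \<Longrightarrow> T \<rhd> \<Gamma> \<turnstile> Name a M \<Colon> Bot \<parallel> \<Delta>"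
| typed_Mu2: "T \<rhd> \<Gamma> \<turnstile> M \<Colon> Bot \<parallel> A1 # A2 # \<Delta> \<Longrightarrow> T \<rhd> \<Gamma> \<turnstile> Mu2 A1 A2 M \<Colon> Or A1 A2 \<parallel> \<Delta>"
| typed_Name2: "a1 < length \<Delta> \<Longrightarrow> a2 < length \<Delta> \<Longrightarrow> T \<rhd> \<Gamma> \<turnstile> M \<Colon> Or (\<Delta> ! a1) (\<Delta> ! a2) \<parallel> \<Delta> \<Longrightarrow>
    T \<rhd> \<Gamma> \<turnstile> Name2 a1 a2 M \<Colon> Bot \<parallel> \<Delta>"

definition lambda_mu_theory :: "('t, 'c) lmtheory \<Rightarrow> bool" where
  "lambda_mu_theory T \<longleftrightarrow>
     (\<forall>(\<Gamma>, M, N, A, \<Delta>) \<in> eqns T. (T \<rhd> \<Gamma> \<turnstile> M \<Colon> A \<parallel> \<Delta>) \<and> (T \<rhd> \<Gamma> \<turnstile> N \<Colon> A \<parallel> \<Delta>))"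

text \<open>
  In \<open>eq_eqn\<close> the additional equations may be used in larger contexts; extending a context at its
  end does not change indices. In \<open>eq_Name2_Mu\<close> the control variable with index 0 no longer occurs
  after the structural substitution, so that the other indices can be shifted down.
\<close>

inductive eqv ::
  "('t, 'c) lmtheory \<Rightarrow> 't ty list \<Rightarrow> ('t, 'c) trm \<Rightarrow> ('t, 'c) trm \<Rightarrow> 't ty \<Rightarrow> 't ty list \<Rightarrow> bool"
  ("_ \<rhd> _ \<turnstile> _ \<approx> _ \<Colon> _ \<parallel> _" [51, 51, 51, 51, 51, 51] 50)
  for T where
  eq_eqn: "(\<Gamma>, M, N, A, \<Delta>) \<in> eqns T \<Longrightarrow> T \<rhd> \<Gamma> @ \<Gamma>' \<turnstile> M \<approx> N \<Colon> A \<parallel> \<Delta> @ \<Delta>'"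

| eq_refl: "T \<rhd> \<Gamma> \<turnstile> M \<Colon> A \<parallel> \<Delta> \<Longrightarrow> T \<rhd> \<Gamma> \<turnstile> M \<approx> M \<Colon> A \<parallel> \<Delta>"
| eq_sym: "T \<rhd> \<Gamma> \<turnstile> M \<approx> N \<Colon> A \<parallel> \<Delta> \<Longrightarrow> T \<rhd> \<Gamma> \<turnstile> N \<approx> M \<Colon> A \<parallel> \<Delta>"
| eq_trans: "T \<rhd> \<Gamma> \<turnstile> M \<approx> N \<Colon> A \<parallel> \<Delta> \<Longrightarrow> T \<rhd> \<Gamma> \<turnstile> N \<approx> P \<Colon> A \<parallel> \<Delta> \<Longrightarrow> T \<rhd> \<Gamma> \<turnstile> M \<approx> P \<Colon> A \<parallel> \<Delta>"

| cong_Lam: "T \<rhd> B # \<Gamma> \<turnstile> M \<approx> M' \<Colon> A \<parallel> \<Delta> \<Longrightarrow> T \<rhd> \<Gamma> \<turnstile> Lam B M \<approx> Lam B M' \<Colon> B \<^bold>\<rightarrow> A \<parallel> \<Delta>"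
| cong_App: "T \<rhd> \<Gamma> \<turnstile> M \<approx> M' \<Colon> B \<^bold>\<rightarrow> A \<parallel> \<Delta> \<Longrightarrow> T \<rhd> \<Gamma> \<turnstile> N \<approx> N' \<Colon> B \<parallel> \<Delta> \<Longrightarrow>
    T \<rhd> \<Gamma> \<turnstile> App M N \<approx> App M' N' \<Colon> A \<parallel> \<Delta>"
| cong_Pair: "T \<rhd> \<Gamma> \<turnstile> M \<approx> M' \<Colon> A \<parallel> \<Delta> \<Longrightarrow> T \<rhd> \<Gamma> \<turnstile> N \<approx> N' \<Colon> B \<parallel> \<Delta> \<Longrightarrow>
    T \<rhd> \<Gamma> \<turnstile> Pair M N \<approx> Pair M' N' \<Colon> Times A B \<parallel> \<Delta>"
| cong_Proj1: "T \<rhd> \<Gamma> \<turnstile> M \<approx> M' \<Colon> Times A B \<parallel> \<Delta> \<Longrightarrow> T \<rhd> \<Gamma> \<turnstile> Proj1 M \<approx> Proj1 M' \<Colon> A \<parallel> \<Delta>"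
| cong_Proj2: "T \<rhd> \<Gamma> \<turnstile> M \<approx> M' \<Colon> Times A B \<parallel> \<Delta> \<Longrightarrow> T \<rhd> \<Gamma> \<turnstile> Proj2 M \<approx> Proj2 M' \<Colon> B \<parallel> \<Delta>"
| cong_Mu: "T \<rhd> \<Gamma> \<turnstile> M \<approx> M' \<Colon> Bot \<parallel> A # \<Delta> \<Longrightarrow> T \<rhd> \<Gamma> \<turnstile> Mu A M \<approx> Mu A M' \<Colon> A \<parallel> \<Delta>"
| cong_Name: "a < length \<Delta> \<Longrightarrow> T \<rhd> \<Gamma> \<turnstile> M \<approx> M' \<Colon> \<Delta> ! a \<parallel> \<Delta> \<Longrightarrow>
    T \<rhd> \<Gamma> \<turnstile> Name a M \<approx> Name a M' \<Colon> Bot \<parallel> \<Delta>"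
| cong_Mu2: "T \<rhd> \<Gamma> \<turnstile> M \<approx> M' \<Colon> Bot \<parallel> A1 # A2 # \<Delta> \<Longrightarrow>
    T \<rhd> \<Gamma> \<turnstile> Mu2 A1 A2 M \<approx> Mu2 A1 A2 M' \<Colon> Or A1 A2 \<parallel> \<Delta>"
| cong_Name2: "a1 < length \<Delta> \<Longrightarrow> a2 < length \<Delta> \<Longrightarrow>
    T \<rhd> \<Gamma> \<turnstile> M \<approx> M' \<Colon> Or (\<Delta> ! a1) (\<Delta> ! a2) \<parallel> \<Delta> \<Longrightarrow>
    T \<rhd> \<Gamma> \<turnstile> Name2 a1 a2 M \<approx> Name2 a1 a2 M' \<Colon> Bot \<parallel> \<Delta>"

| eq_beta: "T \<rhd> B # \<Gamma> \<turnstile> M \<Colon> A \<parallel> \<Delta> \<Longrightarrow> T \<rhd> \<Gamma> \<turnstile> N \<Colon> B \<parallel> \<Delta> \<Longrightarrow>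
    T \<rhd> \<Gamma> \<turnstile> App (Lam B M) N \<approx> inst M N \<Colon> A \<parallel> \<Delta>"
| eq_eta: "T \<rhd> \<Gamma> \<turnstile> M \<Colon> B \<^bold>\<rightarrow> A \<parallel> \<Delta> \<Longrightarrow>
    T \<rhd> \<Gamma> \<turnstile> Lam B (App (renv Suc M) (Var 0)) \<approx> M \<Colon> B \<^bold>\<rightarrow> A \<parallel> \<Delta>"
| eq_Proj1: "T \<rhd> \<Gamma> \<turnstile> M \<Colon> A \<parallel> \<Delta> \<Longrightarrow> T \<rhd> \<Gamma> \<turnstile> N \<Colon> B \<parallel> \<Delta> \<Longrightarrow>
    T \<rhd> \<Gamma> \<turnstile> Proj1 (Pair M N) \<approx> M \<Colon> A \<parallel> \<Delta>"
| eq_Proj2: "T \<rhd> \<Gamma> \<turnstile> M \<Colon> A \<parallel> \<Delta> \<Longrightarrow> T \<rhd> \<Gamma> \<turnstile> N \<Colon> B \<parallel> \<Delta> \<Longrightarrow>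
    T \<rhd> \<Gamma> \<turnstile> Proj2 (Pair M N) \<approx> N \<Colon> B \<parallel> \<Delta>"
| eq_Pair: "T \<rhd> \<Gamma> \<turnstile> M \<Colon> Times A B \<parallel> \<Delta> \<Longrightarrow>
    T \<rhd> \<Gamma> \<turnstile> Pair (Proj1 M) (Proj2 M) \<approx> M \<Colon> Times A B \<parallel> \<Delta>"
| eq_Unit: "T \<rhd> \<Gamma> \<turnstile> M \<Colon> Top \<parallel> \<Delta> \<Longrightarrow> T \<rhd> \<Gamma> \<turnstile> Unit \<approx> M \<Colon> Top \<parallel> \<Delta>"

| eq_Name_Mu: "b < length \<Delta> \<Longrightarrow> T \<rhd> \<Gamma> \<turnstile> M \<Colon> Bot \<parallel> (\<Delta> ! b) # \<Delta> \<Longrightarrow>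
    T \<rhd> \<Gamma> \<turnstile> Name b (Mu (\<Delta> ! b) M) \<approx> renc (case_nat b (\<lambda>n. n)) M \<Colon> Bot \<parallel> \<Delta>"
| eq_Mu_Name: "T \<rhd> \<Gamma> \<turnstile> M \<Colon> A \<parallel> \<Delta> \<Longrightarrow> T \<rhd> \<Gamma> \<turnstile> Mu A (Name 0 (renc Suc M)) \<approx> M \<Colon> A \<parallel> \<Delta>"
| eq_Name2_Mu2: "b1 < length \<Delta> \<Longrightarrow> b2 < length \<Delta> \<Longrightarrow>
    T \<rhd> \<Gamma> \<turnstile> M \<Colon> Bot \<parallel> (\<Delta> ! b1) # (\<Delta> ! b2) # \<Delta> \<Longrightarrow>
    T \<rhd> \<Gamma> \<turnstile> Name2 b1 b2 (Mu2 (\<Delta> ! b1) (\<Delta> ! b2) M)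
      \<approx> renc (case_nat b1 (case_nat b2 (\<lambda>n. n))) M \<Colon> Bot \<parallel> \<Delta>"
| eq_Mu2_Name2: "T \<rhd> \<Gamma> \<turnstile> M \<Colon> Or A1 A2 \<parallel> \<Delta> \<Longrightarrow>
    T \<rhd> \<Gamma> \<turnstile> Mu2 A1 A2 (Name2 0 1 (renc (\<lambda>i. Suc (Suc i)) M)) \<approx> M \<Colon> Or A1 A2 \<parallel> \<Delta>"
| eq_Name_Bot: "b < length \<Delta> \<Longrightarrow> \<Delta> ! b = Bot \<Longrightarrow> T \<rhd> \<Gamma> \<turnstile> M \<Colon> Bot \<parallel> \<Delta> \<Longrightarrow>
    T \<rhd> \<Gamma> \<turnstile> Name b M \<approx> M \<Colon> Bot \<parallel> \<Delta>"
| eq_App_Mu: "T \<rhd> \<Gamma> \<turnstile> M \<Colon> Bot \<parallel> (B \<^bold>\<rightarrow> A) # \<Delta> \<Longrightarrow> T \<rhd> \<Gamma> \<turnstile> N \<Colon> B \<parallel> \<Delta> \<Longrightarrow>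
    T \<rhd> \<Gamma> \<turnstile> App (Mu (B \<^bold>\<rightarrow> A) M) N
      \<approx> Mu A (ssub (B \<^bold>\<rightarrow> A) 0 (Name 0 (App (Var 0) (renv Suc (renc Suc N)))) M) \<Colon> A \<parallel> \<Delta>"
| eq_Proj1_Mu: "T \<rhd> \<Gamma> \<turnstile> M \<Colon> Bot \<parallel> Times A B # \<Delta> \<Longrightarrow>
    T \<rhd> \<Gamma> \<turnstile> Proj1 (Mu (Times A B) M)
      \<approx> Mu A (ssub (Times A B) 0 (Name 0 (Proj1 (Var 0))) M) \<Colon> A \<parallel> \<Delta>"
| eq_Proj2_Mu: "T \<rhd> \<Gamma> \<turnstile> M \<Colon> Bot \<parallel> Times A B # \<Delta> \<Longrightarrow>
    T \<rhd> \<Gamma> \<turnstile> Proj2 (Mu (Times A B) M)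
      \<approx> Mu B (ssub (Times A B) 0 (Name 0 (Proj2 (Var 0))) M) \<Colon> B \<parallel> \<Delta>"
| eq_Name2_Mu: "a1 < length \<Delta> \<Longrightarrow> a2 < length \<Delta> \<Longrightarrow>
    T \<rhd> \<Gamma> \<turnstile> M \<Colon> Bot \<parallel> Or (\<Delta> ! a1) (\<Delta> ! a2) # \<Delta> \<Longrightarrow>
    T \<rhd> \<Gamma> \<turnstile> Name2 a1 a2 (Mu (Or (\<Delta> ! a1) (\<Delta> ! a2)) M)
      \<approx> renc (\<lambda>n. n - 1)
          (ssub (Or (\<Delta> ! a1) (\<Delta> ! a2)) 0 (Name2 (Suc a1) (Suc a2) (Var 0)) M) \<Colon> Bot \<parallel> \<Delta>"

text \<open>
  The category of a theory: a morphism from \<open>B\<close> to \<open>A\<close> is represented by a closed term of type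
  \<open>B \<^bold>\<rightarrow> A\<close>, and equality of morphisms is \<open>fun_eq\<close>.
\<close>

definition is_fun :: "('t, 'c) lmtheory \<Rightarrow> ('t, 'c) trm \<Rightarrow> 't ty \<Rightarrow> 't ty \<Rightarrow> bool" where
  "is_fun T F B A \<longleftrightarrow> (T \<rhd> [] \<turnstile> F \<Colon> B \<^bold>\<rightarrow> A \<parallel> [])"

definition fun_eq ::
  "('t, 'c) lmtheory \<Rightarrow> 't ty \<Rightarrow> 't ty \<Rightarrow> ('t, 'c) trm \<Rightarrow> ('t, 'c) trm \<Rightarrow> bool" where
  "fun_eq T B A F G \<longleftrightarrow> (T \<rhd> [] \<turnstile> F \<approx> G \<Colon> B \<^bold>\<rightarrow> A \<parallel> [])"

definition id_fun :: "'t ty \<Rightarrow> ('t, 'c) trm" where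
  "id_fun A = Lam A (Var 0)"

text \<open>\<open>comp_fun B G F\<close> is \<open>G \<circ> F\<close>, where \<open>B\<close> is the domain of \<open>F\<close>.\<close>

definition comp_fun :: "'t ty \<Rightarrow> ('t, 'c) trm \<Rightarrow> ('t, 'c) trm \<Rightarrow> ('t, 'c) trm" where
  "comp_fun B G F = Lam B (App (renv Suc G) (App (renv Suc F) (Var 0)))"

text \<open>\<open>neg_fun B A F\<close> is \<open>\<not>F = \<lambda>k. \<lambda>x. k (F x) : \<not>A \<rightarrow> \<not>B\<close> for \<open>F : B \<rightarrow> A\<close>.\<close>

definition neg_fun :: "'t ty \<Rightarrow> 't ty \<Rightarrow> ('t, 'c) trm \<Rightarrow> ('t, 'c) trm" where
  "neg_fun B A F =
     Lam (Neg A) (Lam B (App (Var 1) (App (renv (\<lambda>i. Suc (Suc i)) F) (Var 0))))"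

definition focal :: "('t, 'c) lmtheory \<Rightarrow> ('t, 'c) trm \<Rightarrow> 't ty \<Rightarrow> 't ty \<Rightarrow> bool" where
  "focal T F B A \<longleftrightarrow> is_fun T F B A \<and>
     (\<forall>\<Gamma> \<Delta> M. (T \<rhd> \<Gamma> \<turnstile> M \<Colon> Bot \<parallel> B # \<Delta>) \<longrightarrow>
        (T \<rhd> \<Gamma> \<turnstile> App F (Mu B M)
           \<approx> Mu A (ssub B 0 (Name 0 (App (renv Suc (renc Suc F)) (Var 0))) M) \<Colon> A \<parallel> \<Delta>))"

text \<open>
  A functor consists of a map \<open>Go\<close> on types and a map \<open>Gm\<close> on functions. As morphisms are terms
  modulo equality, \<open>Gm\<close> has to respect equality.
\<close>

definition lm_functor ::
  "('t, 'c) lmtheory \<Rightarrow> ('t ty \<Rightarrow> 't ty) \<Rightarrow> (('t, 'c) trm \<Rightarrow> ('t, 'c) trm) \<Rightarrow> bool" where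
  "lm_functor T Go Gm \<longleftrightarrow>
     (\<forall>A B F. is_fun T F A B \<longrightarrow> is_fun T (Gm F) (Go A) (Go B)) \<and>
     (\<forall>A B F F'. is_fun T F A B \<longrightarrow> is_fun T F' A B \<longrightarrow> fun_eq T A B F F' \<longrightarrow>
        fun_eq T (Go A) (Go B) (Gm F) (Gm F')) \<and>
     (\<forall>A. fun_eq T (Go A) (Go A) (Gm (id_fun A)) (id_fun (Go A))) \<and>
     (\<forall>A B C F G. is_fun T F A B \<longrightarrow> is_fun T G B C \<longrightarrow>
        fun_eq T (Go A) (Go C) (Gm (comp_fun A G F)) (comp_fun (Go A) (Gm G) (Gm F))) \<and>
     (\<forall>A B F. focal T F A B \<longrightarrow> focal T (Gm F) (Go A) (Go B))"

text \<open>The value of \<open>Fm\<close> on terms which are not focal functions is irrelevant.\<close>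

definition focus_functor ::
  "('t, 'c) lmtheory \<Rightarrow> ('t ty \<Rightarrow> 't ty) \<Rightarrow> (('t, 'c) trm \<Rightarrow> ('t, 'c) trm) \<Rightarrow> bool" where
  "focus_functor T Fo Fm \<longleftrightarrow>
     (\<forall>A B F. focal T F A B \<longrightarrow> focal T (Fm F) (Fo A) (Fo B)) \<and>
     (\<forall>A B F F'. focal T F A B \<longrightarrow> focal T F' A B \<longrightarrow> fun_eq T A B F F' \<longrightarrow>
        fun_eq T (Fo A) (Fo B) (Fm F) (Fm F')) \<and>
     (\<forall>A. fun_eq T (Fo A) (Fo A) (Fm (id_fun A)) (id_fun (Fo A))) \<and>
     (\<forall>A B C F G. focal T F A B \<longrightarrow> focal T G B C \<longrightarrow>
        fun_eq T (Fo A) (Fo C) (Fm (comp_fun A G F)) (comp_fun (Fo A) (Fm G) (Fm F)))"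

text \<open>
  A natural isomorphism \<open>\<phi>\<^sub>\<alpha> : \<not>\<G>\<alpha> \<cong> \<F>(\<not>\<alpha>)\<close> with inverses \<open>\<psi>\<^sub>\<alpha>\<close>. Both sides are contravariant
  functors into the category of focal functions (a function of the form \<open>\<not>F\<close> is always focal, and
  \<open>\<F>\<close> acts only on focal functions), so the components are focal; the inverse of a focal
  isomorphism is again focal.
\<close>

definition dual_natural_iso ::
  "('t, 'c) lmtheory \<Rightarrow> ('t ty \<Rightarrow> 't ty) \<Rightarrow> (('t, 'c) trm \<Rightarrow> ('t, 'c) trm) \<Rightarrow>
   ('t ty \<Rightarrow> 't ty) \<Rightarrow> (('t, 'c) trm \<Rightarrow> ('t, 'c) trm) \<Rightarrow>
   ('t ty \<Rightarrow> ('t, 'c) trm) \<Rightarrow> ('t ty \<Rightarrow> ('t, 'c) trm) \<Rightarrow> bool" where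
  "dual_natural_iso T Go Gm Fo Fm \<phi> \<psi> \<longleftrightarrow>
     (\<forall>A. focal T (\<phi> A) (Neg (Go A)) (Fo (Neg A)) \<and>
          is_fun T (\<psi> A) (Fo (Neg A)) (Neg (Go A)) \<and>
          fun_eq T (Neg (Go A)) (Neg (Go A))
            (comp_fun (Neg (Go A)) (\<psi> A) (\<phi> A)) (id_fun (Neg (Go A))) \<and>
          fun_eq T (Fo (Neg A)) (Fo (Neg A))
            (comp_fun (Fo (Neg A)) (\<phi> A) (\<psi> A)) (id_fun (Fo (Neg A)))) \<and>
     (\<forall>A B F. is_fun T F A B \<longrightarrow>
        fun_eq T (Neg (Go B)) (Fo (Neg A))
          (comp_fun (Neg (Go B)) (\<phi> A) (neg_fun (Go A) (Go B) (Gm F)))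
          (comp_fun (Neg (Go B)) (Fm (neg_fun A B F)) (\<phi> B)))"

definition final_coalgebra ::
  "('t, 'c) lmtheory \<Rightarrow> ('t ty \<Rightarrow> 't ty) \<Rightarrow> (('t, 'c) trm \<Rightarrow> ('t, 'c) trm) \<Rightarrow>
   't ty \<Rightarrow> ('t, 'c) trm \<Rightarrow> bool" where
  "final_coalgebra T Go Gm C X \<longleftrightarrow> is_fun T X C (Go C) \<and>
     (\<forall>A F. is_fun T F A (Go A) \<longrightarrow>
        (\<exists>H. is_fun T H A C \<and>
             fun_eq T A (Go C) (comp_fun A X H) (comp_fun A (Gm H) F) \<and>
             (\<forall>H'. is_fun T H' A C \<longrightarrow>
                   fun_eq T A (Go C) (comp_fun A X H') (comp_fun A (Gm H') F) \<longrightarrow>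
                   fun_eq T A C H' H)))"

definition focally_initial_algebra ::
  "('t, 'c) lmtheory \<Rightarrow> ('t ty \<Rightarrow> 't ty) \<Rightarrow> (('t, 'c) trm \<Rightarrow> ('t, 'c) trm) \<Rightarrow>
   't ty \<Rightarrow> ('t, 'c) trm \<Rightarrow> bool" where
  "focally_initial_algebra T Fo Fm C X \<longleftrightarrow> focal T X (Fo C) C \<and>
     (\<forall>A F. focal T F (Fo A) A \<longrightarrow>
        (\<exists>H. focal T H C A \<and>
             fun_eq T (Fo C) A (comp_fun (Fo C) H X) (comp_fun (Fo C) F (Fm H)) \<and>
             (\<forall>H'. focal T H' C A \<longrightarrow>
                   fun_eq T (Fo C) A (comp_fun (Fo C) H' X) (comp_fun (Fo C) F (Fm H')) \<longrightarrow>
                   fun_eq T C A H' H)))"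

end

theory Submission
  imports Defs
begin

text \<open>
  Write \<open>\<epsilon>\<^sub>A = \<lambda>k. \<mu>a. k (\<lambda>x. a x) : \<not>\<not>A \<rightarrow> A\<close> and \<open>\<eta>\<^sub>A = \<lambda>x. \<lambda>k. k x : A \<rightarrow> \<not>\<not>A\<close>. A function
  \<open>F : B \<rightarrow> A\<close> is focal iff \<open>F \<circ> \<epsilon>\<^sub>B = \<epsilon>\<^sub>A \<circ> \<not>\<not>F\<close>, because \<open>\<mu>a. M = \<epsilon> (\<lambda>h. M[a\<box> := h \<box>])\<close>. With
  \<open>\<epsilon> \<circ> \<eta> = id\<close>, \<open>\<epsilon>\<^bsub>\<not>A\<^esub> = \<not>\<eta>\<^sub>A\<close> and the naturality of \<open>\<eta>\<close>, the rest happens in the category of functions.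

  The carrier of an algebra need not be a negation, but every focal \<open>f : \<not>Y \<rightarrow> A\<close> has a focal transpose
  \<open>f\<^sup>* = \<epsilon>\<^sub>Y \<circ> \<not>f : \<not>A \<rightarrow> Y\<close> with \<open>\<epsilon>\<^sub>A \<circ> \<not>f\<^sup>* = f\<close>, and \<open>X \<circ> f\<^sup>* = (f \<circ> \<not>X)\<^sup>*\<close> for focal \<open>X\<close>. A focal
  algebra \<open>F : \<F>A \<rightarrow> A\<close> thus yields \<open>f = F \<circ> \<F>\<epsilon> \<circ> \<phi> : \<not>\<G>\<not>A \<rightarrow> A\<close> and the coalgebra \<open>f\<^sup>* : \<not>A \<rightarrow> \<G>\<not>A\<close>.
  If \<open>H : \<not>A \<rightarrow> C\<close> is its coalgebra morphism into \<open>C\<close>, then \<open>\<epsilon> \<circ> \<not>H\<close> is the algebra morphism. It is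
  unique, since the transpose of any focal algebra morphism \<open>\<not>C \<rightarrow> A\<close> is a coalgebra morphism; here
  the focality of \<open>X\<close> is used.
\<close>

section \<open>Renaming and substitution\<close>

lemma up_simps [simp]: "up f 0 = 0" "up f (Suc n) = Suc (f n)"
  by (simp_all add: up_def)

lemma up_up: "up f (up g n) = up (\<lambda>i. f (g i)) n"
  by (cases n) simp_all

lemma up_id [simp]: "up (\<lambda>i. i) = (\<lambda>i. i)"
proof
  show "up (\<lambda>i. i) n = n" for n by (cases n) simp_all
qed

lemma renc_renc: "renc f (renc g M) = renc (\<lambda>n. f (g n)) M"
  by (induction M arbitrary: f g) (simp_all add: up_up)

lemma renc_renv: "renc g (renv f M) = renv f (renc g M)"
  by (induction M arbitrary: f g) simp_all

lemma renc_id [simp]: "renc (\<lambda>n. n) M = M"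
  by (induction M) simp_all

lemma renc_up_renc_Suc: "renc (up g) (renc Suc M) = renc Suc (renc g M)"
  by (simp add: renc_renc)

lemma renc_up_up_renc_Suc_Suc:
  "renc (up (up g)) (renc (\<lambda>i. Suc (Suc i)) M) = renc (\<lambda>i. Suc (Suc i)) (renc g M)"
  by (simp add: renc_renc)

lemma renc_subst: "renc g (subst s M) = subst (\<lambda>n. renc g (s n)) (renc g M)"
proof (induction M arbitrary: g s)
  case (Lam A M)
  have "(\<lambda>n. renc g (case n of 0 \<Rightarrow> Var 0 | Suc n \<Rightarrow> renv Suc (s n)))
    = case_nat (Var 0) (\<lambda>n. renv Suc (renc g (s n)))"
    by (rule ext) (simp add: renc_renv split: nat.split)
  with Lam show ?case by simp
qed (simp_all add: renc_up_renc_Suc renc_up_up_renc_Suc_Suc)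

lemma renc_inst: "renc g (inst M N) = inst (renc g M) (renc g N)"
proof -
  have "(\<lambda>n. renc g (case n of 0 \<Rightarrow> N | Suc n \<Rightarrow> Var n)) = case_nat (renc g N) Var"
    by (rule ext) (simp split: nat.split)
  then show ?thesis by (simp add: inst_def renc_subst)
qed

lemma subst_renv: "subst s (renv f M) = subst (\<lambda>n. s (f n)) M"
proof (induction M arbitrary: s f)
  case (Lam A M)
  have "(\<lambda>n. case up f n of 0 \<Rightarrow> Var 0 | Suc n \<Rightarrow> renv Suc (s n))
    = case_nat (Var 0) (\<lambda>n. renv Suc (s (f n)))"
    by (rule ext) (simp split: nat.split)
  with Lam show ?case by simp
qed simp_all

lemma case_nat_Var_Suc: "case_nat (Var 0) (\<lambda>n. Var (Suc n)) = Var"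
  by (rule ext) (simp split: nat.split)

lemma subst_Var [simp]: "subst Var M = M"
  by (induction M) (simp_all add: case_nat_Var_Suc)

lemma inst_renv_Suc [simp]: "inst (renv Suc M) N = M"
  by (simp add: inst_def subst_renv)

lemma inst_simps [simp]:
  "inst (Const c) P = Const c"
  "inst (Var 0) P = P"
  "inst (Var (Suc n)) P = Var n"
  "inst (App M N) P = App (inst M P) (inst N P)"
  "inst (Name a M) P = Name a (inst M P)"
  "inst (Name2 a b M) P = Name2 a b (inst M P)"
  "inst (Mu A M) P = Mu A (inst M (renc Suc P))"
proof -
  have "(\<lambda>n. renc Suc (case n of 0 \<Rightarrow> P | Suc n \<Rightarrow> Var n)) = case_nat (renc Suc P) Var"
    by (rule ext) (simp split: nat.split)
  then show "inst (Mu A M) P = Mu A (inst M (renc Suc P))"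
    by (simp add: inst_def)
qed (simp_all add: inst_def)

text \<open>After the replacement, index \<open>a\<close> survives only through occurrences in
  \<open>C\<close>, so a renaming that moves at most \<open>a\<close> and fixes \<open>C\<close> has
  nothing to act on. It is applied to the renaming that sends 0 to 1 and fixes the rest: shifting
  down and then up again does no harm once index 0 is gone.\<close>

lemma renc_ssub_fresh:
  assumes "\<And>i. i \<noteq> a \<Longrightarrow> g i = i" and "renc g C = C"
  shows "renc g (ssub A a C M) = ssub A a C (M :: ('t, 'c) trm)"
  using assms
proof (induction M arbitrary: a g C)
  case (Lam B M)
  then show ?case by (simp add: renc_renv)
next
  case (Mu B M)
  have "up g i = i" if "i \<noteq> Suc a" for i
    using that Mu.prems(1) by (cases i) simp_all
  then show ?case using Mu by (simp add: renc_up_renc_Suc)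
next
  case (Mu2 B1 B2 M)
  have "up (up g) i = i" if "i \<noteq> Suc (Suc a)" for i
    using that Mu2.prems(1) by (cases i; cases "i - 1") auto
  then show ?case using Mu2 by (simp add: renc_up_up_renc_Suc_Suc)
next
  case (Name b M)
  then show ?case by (simp add: renc_inst)
next
  case (Name2 b1 b2 M)
  have IH: "renc g (ssub A a C M) = ssub A a C M"
    using Name2 by blast
  show ?case
    using IH Name2.prems by (simp add: renc_inst renc_up_renc_Suc)
qed simp_all

section \<open>Typing\<close>

lemma typed_VarI: "n < length \<Gamma> \<Longrightarrow> \<Gamma> ! n = A \<Longrightarrow> T \<rhd> \<Gamma> \<turnstile> Var n \<Colon> A \<parallel> \<Delta>"
  using typed_Var by blast

lemma typed_NameI: "a < length \<Delta> \<Longrightarrow> \<Delta> ! a = A \<Longrightarrow> T \<rhd> \<Gamma> \<turnstile> M \<Colon> A \<parallel> \<Delta> \<Longrightarrow> T \<rhd> \<Gamma> \<turnstile> Name a M \<Colon> Bot \<parallel> \<Delta>"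
  using typed_Name by blast

lemma typed_Name2I:
  "a < length \<Delta> \<Longrightarrow> b < length \<Delta> \<Longrightarrow> \<Delta> ! a = A \<Longrightarrow> \<Delta> ! b = B \<Longrightarrow> T \<rhd> \<Gamma> \<turnstile> M \<Colon> Or A B \<parallel> \<Delta> \<Longrightarrow>
    T \<rhd> \<Gamma> \<turnstile> Name2 a b M \<Colon> Bot \<parallel> \<Delta>"
  using typed_Name2 by blast

lemma typed_append: "T \<rhd> \<Gamma> \<turnstile> M \<Colon> A \<parallel> \<Delta> \<Longrightarrow> T \<rhd> \<Gamma> @ \<Gamma>' \<turnstile> M \<Colon> A \<parallel> \<Delta> @ \<Delta>'"
  by (induction rule: typed.induct)
    (auto intro!: typed_Const typed_VarI typed_Lam typed_Unit typed_Pair typed_Mu typed_Mu2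
      intro: typed_App typed_Proj1 typed_Proj2 typed_NameI typed_Name2I simp: nth_append)

lemma typed_renv:
  assumes "T \<rhd> \<Gamma> \<turnstile> M \<Colon> A \<parallel> \<Delta>"
    and "\<And>i. i < length \<Gamma> \<Longrightarrow> f i < length \<Gamma>' \<and> \<Gamma>' ! f i = \<Gamma> ! i"
  shows "T \<rhd> \<Gamma>' \<turnstile> renv f M \<Colon> A \<parallel> \<Delta>"
  using assms
proof (induction arbitrary: f \<Gamma>' rule: typed.induct)
  case (typed_Lam B \<Gamma> M A \<Delta>)
  have "up f i < length (B # \<Gamma>') \<and> (B # \<Gamma>') ! up f i = (B # \<Gamma>) ! i"
    if "i < length (B # \<Gamma>)" for i
    using that typed_Lam.prems by (cases i) auto
  then show ?case by (auto intro!: typed.typed_Lam typed_Lam.IH)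
next
  case (typed_App \<Gamma> M B A \<Delta> N)
  show ?case
    using typed_App.IH[OF typed_App.prems] by (auto intro: typed.typed_App)
qed (auto intro: typed.intros typed_VarI)

lemma typed_renc:
  assumes "T \<rhd> \<Gamma> \<turnstile> M \<Colon> A \<parallel> \<Delta>"
    and "\<And>i. i < length \<Delta> \<Longrightarrow> g i < length \<Delta>' \<and> \<Delta>' ! g i = \<Delta> ! i"
  shows "T \<rhd> \<Gamma> \<turnstile> renc g M \<Colon> A \<parallel> \<Delta>'"
  using assms
proof (induction arbitrary: g \<Delta>' rule: typed.induct)
  case (typed_Mu \<Gamma> M A \<Delta>)
  have "up g i < length (A # \<Delta>') \<and> (A # \<Delta>') ! up g i = (A # \<Delta>) ! i"
    if "i < length (A # \<Delta>)" for i
    using that typed_Mu.prems by (cases i) auto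
  then show ?case by (auto intro!: typed.typed_Mu typed_Mu.IH)
next
  case (typed_Mu2 \<Gamma> M A1 A2 \<Delta>)
  have "up (up g) i < length (A1 # A2 # \<Delta>') \<and> (A1 # A2 # \<Delta>') ! up (up g) i = (A1 # A2 # \<Delta>) ! i"
    if "i < length (A1 # A2 # \<Delta>)" for i
    using that typed_Mu2.prems by (cases i; cases "i - 1") auto
  then show ?case by (auto intro!: typed.typed_Mu2 typed_Mu2.IH)
next
  case (typed_Name a \<Delta> \<Gamma> M)
  then show ?case by (auto intro: typed_NameI)
next
  case (typed_Name2 a1 \<Delta> a2 \<Gamma> M)
  then show ?case by (auto intro!: typed_Name2I)
next
  case (typed_App \<Gamma> M B A \<Delta> N)
  show ?case
    using typed_App.IH[OF typed_App.prems] by (auto intro: typed.typed_App)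
qed (auto intro: typed.intros typed_VarI)

lemma typed_weaken_var: "T \<rhd> \<Gamma> \<turnstile> M \<Colon> A \<parallel> \<Delta> \<Longrightarrow> T \<rhd> B # \<Gamma> \<turnstile> renv Suc M \<Colon> A \<parallel> \<Delta>"
  by (erule typed_renv) simp

lemma typed_weaken_control: "T \<rhd> \<Gamma> \<turnstile> M \<Colon> A \<parallel> \<Delta> \<Longrightarrow> T \<rhd> \<Gamma> \<turnstile> renc Suc M \<Colon> A \<parallel> B # \<Delta>"
  by (erule typed_renc) simp

lemma typed_weaken_control2:
  "T \<rhd> \<Gamma> \<turnstile> M \<Colon> A \<parallel> \<Delta> \<Longrightarrow> T \<rhd> \<Gamma> \<turnstile> renc (\<lambda>i. Suc (Suc i)) M \<Colon> A \<parallel> B1 # B2 # \<Delta>"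
  by (erule typed_renc) simp

inductive_cases typed_ConstE: "T \<rhd> \<Gamma> \<turnstile> Const c \<Colon> A \<parallel> \<Delta>"
inductive_cases typed_VarE: "T \<rhd> \<Gamma> \<turnstile> Var n \<Colon> A \<parallel> \<Delta>"
inductive_cases typed_LamE: "T \<rhd> \<Gamma> \<turnstile> Lam B M \<Colon> A \<parallel> \<Delta>"
inductive_cases typed_AppE: "T \<rhd> \<Gamma> \<turnstile> App M N \<Colon> A \<parallel> \<Delta>"
inductive_cases typed_UnitE: "T \<rhd> \<Gamma> \<turnstile> Unit \<Colon> A \<parallel> \<Delta>"
inductive_cases typed_PairE: "T \<rhd> \<Gamma> \<turnstile> Pair M N \<Colon> A \<parallel> \<Delta>"
inductive_cases typed_Proj1E: "T \<rhd> \<Gamma> \<turnstile> Proj1 M \<Colon> A \<parallel> \<Delta>"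
inductive_cases typed_Proj2E: "T \<rhd> \<Gamma> \<turnstile> Proj2 M \<Colon> A \<parallel> \<Delta>"
inductive_cases typed_MuE: "T \<rhd> \<Gamma> \<turnstile> Mu B M \<Colon> A \<parallel> \<Delta>"
inductive_cases typed_NameE: "T \<rhd> \<Gamma> \<turnstile> Name a M \<Colon> A \<parallel> \<Delta>"
inductive_cases typed_Mu2E: "T \<rhd> \<Gamma> \<turnstile> Mu2 A1 A2 M \<Colon> A \<parallel> \<Delta>"
inductive_cases typed_Name2E: "T \<rhd> \<Gamma> \<turnstile> Name2 a b M \<Colon> A \<parallel> \<Delta>"

lemma typed_renc_strengthen:
  assumes "T \<rhd> \<Gamma> \<turnstile> renc g M \<Colon> A \<parallel> \<Delta>'"
    and "\<And>i. g i < length \<Delta>' \<Longrightarrow> i < length \<Delta> \<and> \<Delta> ! i = \<Delta>' ! g i"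
  shows "T \<rhd> \<Gamma> \<turnstile> M \<Colon> A \<parallel> \<Delta>"
  using assms
proof (induction M arbitrary: \<Gamma> A g \<Delta> \<Delta>')
  case (Mu B M)
  have "i < length (B # \<Delta>) \<and> (B # \<Delta>) ! i = (B # \<Delta>') ! up g i"
    if "up g i < length (B # \<Delta>')" for i
    using that Mu.prems(2) by (cases i) auto
  with Mu.prems(1) Mu.IH show ?case
    by (fastforce elim!: typed_MuE intro!: typed_Mu)
next
  case (Mu2 B1 B2 M)
  have "i < length (B1 # B2 # \<Delta>) \<and> (B1 # B2 # \<Delta>) ! i = (B1 # B2 # \<Delta>') ! up (up g) i"
    if "up (up g) i < length (B1 # B2 # \<Delta>')" for i
    using that Mu2.prems(2) by (cases i; cases "i - 1") auto
  with Mu2.prems(1) Mu2.IH show ?case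
    by (fastforce elim!: typed_Mu2E intro!: typed_Mu2)
next
  case (Name a M)
  from Name.prems(1) show ?case
    by (auto elim!: typed_NameE dest!: Name.prems(2) intro!: typed_NameI Name.IH[OF _ Name.prems(2)])
next
  case (Name2 a b M)
  from Name2.prems(1) show ?case
    by (auto elim!: typed_Name2E dest!: Name2.prems(2)
        intro!: typed_Name2I Name2.IH[OF _ Name2.prems(2)])
next
  case (App M N)
  from App.prems(1) show ?case
    by (auto elim!: typed_AppE intro: typed_App App.IH[OF _ App.prems(2)])
next
  case (Proj1 M)
  from Proj1.prems(1) show ?case
    by (auto elim!: typed_Proj1E intro: typed_Proj1 Proj1.IH[OF _ Proj1.prems(2)])
next
  case (Proj2 M)
  from Proj2.prems(1) show ?case
    by (auto elim!: typed_Proj2E intro: typed_Proj2 Proj2.IH[OF _ Proj2.prems(2)])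
next
  case (Lam B M)
  from Lam.prems(1) show ?case
    by (auto elim!: typed_LamE intro: typed_Lam Lam.IH[OF _ Lam.prems(2)])
next
  case (Pair M N)
  from Pair.prems(1) show ?case
    by (auto elim!: typed_PairE intro: typed_Pair Pair.IH[OF _ Pair.prems(2)])
qed (auto elim!: typed_ConstE typed_VarE typed_UnitE intro: typed_Const typed_Var typed_Unit)

lemma typed_strengthen_control: "T \<rhd> \<Gamma> \<turnstile> renc Suc M \<Colon> A \<parallel> B # \<Delta> \<Longrightarrow> T \<rhd> \<Gamma> \<turnstile> M \<Colon> A \<parallel> \<Delta>"
  by (erule typed_renc_strengthen) simp

lemma typed_subst:
  assumes "T \<rhd> \<Gamma> \<turnstile> M \<Colon> A \<parallel> \<Delta>"
    and "\<And>i. i < length \<Gamma> \<Longrightarrow> T \<rhd> \<Gamma>' \<turnstile> s i \<Colon> \<Gamma> ! i \<parallel> \<Delta>"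
  shows "T \<rhd> \<Gamma>' \<turnstile> subst s M \<Colon> A \<parallel> \<Delta>"
  using assms
proof (induction arbitrary: s \<Gamma>' rule: typed.induct)
  case (typed_Lam B \<Gamma> M A \<Delta>)
  have "T \<rhd> B # \<Gamma>' \<turnstile> (case i of 0 \<Rightarrow> Var 0 | Suc n \<Rightarrow> renv Suc (s n)) \<Colon> (B # \<Gamma>) ! i \<parallel> \<Delta>"
    if "i < length (B # \<Gamma>)" for i
    using that typed_Lam.prems by (cases i) (auto intro!: typed_VarI typed_weaken_var)
  then show ?case by (auto intro!: typed.typed_Lam typed_Lam.IH)
next
  case (typed_Mu \<Gamma> M A \<Delta>)
  then show ?case by (auto intro!: typed.typed_Mu typed_Mu.IH typed_weaken_control)
next
  case (typed_Mu2 \<Gamma> M A1 A2 \<Delta>)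
  then show ?case by (auto intro!: typed.typed_Mu2 typed_Mu2.IH typed_weaken_control2)
next
  case (typed_App \<Gamma> M B A \<Delta> N)
  show ?case
    using typed_App.IH[OF typed_App.prems] by (auto intro: typed.typed_App)
qed (auto intro: typed.intros)

lemma typed_inst:
  assumes "T \<rhd> B # \<Gamma> \<turnstile> M \<Colon> A \<parallel> \<Delta>" and "T \<rhd> \<Gamma> \<turnstile> N \<Colon> B \<parallel> \<Delta>"
  shows "T \<rhd> \<Gamma> \<turnstile> inst M N \<Colon> A \<parallel> \<Delta>"
  unfolding inst_def
  using assms(2) by (intro typed_subst[OF assms(1)]) (auto simp: less_Suc_eq_0_disj intro: typed_Var)

text \<open>The type \<open>A\<close> at position \<open>a\<close> is constrained only by
  \<open>C\<close>. If \<open>C\<close> does not mention \<open>a\<close>, it can be chosen freely,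
  which later allows \<open>Top\<close> as a placeholder.\<close>

lemma typed_ssub:
  assumes "T \<rhd> \<Gamma> \<turnstile> M \<Colon> D \<parallel> \<Delta>" and "a < length \<Delta>" and "\<Delta> ! a = B"
    and "T \<rhd> B # \<Gamma> \<turnstile> C \<Colon> Bot \<parallel> \<Delta>[a := A]"
  shows "T \<rhd> \<Gamma> \<turnstile> ssub B a C M \<Colon> D \<parallel> \<Delta>[a := A]"
  using assms
proof (induction arbitrary: a C rule: typed.induct)
  case (typed_Lam E \<Gamma> M D \<Delta>)
  have "T \<rhd> B # E # \<Gamma> \<turnstile> renv (up Suc) C \<Colon> Bot \<parallel> \<Delta>[a := A]"
    by (rule typed_renv[OF typed_Lam.prems(3)]) (auto simp: less_Suc_eq_0_disj)
  then show ?case using typed_Lam by (auto intro!: typed.typed_Lam)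
next
  case (typed_Mu \<Gamma> M E \<Delta>)
  show ?case
    using typed_Mu.IH[of "Suc a" "renc Suc C"] typed_Mu.prems
    by (auto intro!: typed.typed_Mu typed_weaken_control)
next
  case (typed_Mu2 \<Gamma> M E1 E2 \<Delta>)
  have "T \<rhd> B # \<Gamma> \<turnstile> renc (\<lambda>i. Suc (Suc i)) C \<Colon> Bot \<parallel> E1 # E2 # \<Delta>[a := A]"
    by (rule typed_weaken_control2[OF typed_Mu2.prems(3)])
  then show ?case
    using typed_Mu2.IH[of "Suc (Suc a)" "renc (\<lambda>i. Suc (Suc i)) C"] typed_Mu2.prems
    by (auto intro!: typed.typed_Mu2)
next
  case (typed_Name b \<Delta> \<Gamma> M)
  then show ?case
    by (auto intro!: typed_NameI typed_inst[OF typed_Name.prems(3)])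
next
  case (typed_Name2 b1 \<Delta> b2 \<Gamma> M)
  let ?N = "ssub B a C M"
  have N: "T \<rhd> \<Gamma> \<turnstile> ?N \<Colon> Or (\<Delta> ! b1) (\<Delta> ! b2) \<parallel> \<Delta>[a := A]"
    using typed_Name2 by blast
  \<comment> \<open>A pair that names the old \<open>a\<close> must become a term of type
    \<open>B\<close> to fill the hole; the binder \<open>Mu B\<close> supplies a local copy of
    \<open>a\<close> at index 0.\<close>
  have "T \<rhd> \<Gamma> \<turnstile> Mu B (Name2 (if b1 = a then 0 else Suc b1) (if b2 = a then 0 else Suc b2)
      (renc Suc ?N)) \<Colon> B \<parallel> \<Delta>[a := A]"
    using typed_Name2.hyps typed_Name2.prems
    by (intro typed_Mu typed_Name2I[OF _ _ _ _ typed_weaken_control[OF N]]) auto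
  then show ?case
    using typed_Name2.hyps N by (auto intro!: typed_Name2I typed_inst[OF typed_Name2.prems(3)])
next
  case (typed_App \<Gamma> M E D \<Delta> N)
  show ?case
    using typed_App.IH[OF typed_App.prems] by (auto intro: typed.typed_App)
qed (auto intro: typed.intros)

text \<open>Free indices of a typed term lie below the length of its context, so what an operation
  does beyond it is invisible. The next three lemmas rest on the same observation.\<close>

lemma renv_fixed:
  assumes "T \<rhd> \<Gamma> \<turnstile> M \<Colon> A \<parallel> \<Delta>" and "\<And>i. i < length \<Gamma> \<Longrightarrow> f i = i"
  shows "renv f M = M"
  using assms
proof (induction arbitrary: f rule: typed.induct)
  case (typed_Lam B \<Gamma> M A \<Delta>)
  have "up f i = i" if "i < length (B # \<Gamma>)" for i
    using that typed_Lam.prems by (cases i) auto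
  with typed_Lam.IH show ?case by simp
qed simp_all

lemma renc_fixed:
  assumes "T \<rhd> \<Gamma> \<turnstile> M \<Colon> A \<parallel> \<Delta>" and "\<And>i. i < length \<Delta> \<Longrightarrow> g i = i"
  shows "renc g M = M"
  using assms
proof (induction arbitrary: g rule: typed.induct)
  case (typed_Mu \<Gamma> M A \<Delta>)
  have "up g i = i" if "i < length (A # \<Delta>)" for i
    using that typed_Mu.prems by (cases i) auto
  with typed_Mu.IH show ?case by simp
next
  case (typed_Mu2 \<Gamma> M A1 A2 \<Delta>)
  have "up (up g) i = i" if "i < length (A1 # A2 # \<Delta>)" for i
    using that typed_Mu2.prems by (cases i; cases "i - 1") auto
  with typed_Mu2.IH show ?case by simp
qed simp_all

lemma subst_fixed:
  assumes "T \<rhd> \<Gamma> \<turnstile> M \<Colon> A \<parallel> \<Delta>" and "\<And>i. i < length \<Gamma> \<Longrightarrow> s i = Var i"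
  shows "subst s M = M"
  using assms
proof (induction arbitrary: s rule: typed.induct)
  case (typed_Lam B \<Gamma> M A \<Delta>)
  have "case_nat (Var 0) (\<lambda>n. renv Suc (s n)) i = Var i" if "i < length (B # \<Gamma>)" for i
    using that typed_Lam.prems by (cases i) auto
  with typed_Lam.IH show ?case by simp
qed simp_all

lemma ssub_fresh:
  assumes "T \<rhd> \<Gamma> \<turnstile> M \<Colon> A \<parallel> \<Delta>" and "length \<Delta> \<le> a"
  shows "ssub B a C M = M"
  using assms by (induction arbitrary: a C rule: typed.induct) auto

section \<open>Equality\<close>

lemma cong_NameI:
  "a < length \<Delta> \<Longrightarrow> \<Delta> ! a = A \<Longrightarrow> T \<rhd> \<Gamma> \<turnstile> M \<approx> M' \<Colon> A \<parallel> \<Delta> \<Longrightarrow>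
    T \<rhd> \<Gamma> \<turnstile> Name a M \<approx> Name a M' \<Colon> Bot \<parallel> \<Delta>"
  using cong_Name by blast

lemma cong_Name2I:
  "a < length \<Delta> \<Longrightarrow> b < length \<Delta> \<Longrightarrow> \<Delta> ! a = A \<Longrightarrow> \<Delta> ! b = B \<Longrightarrow>
    T \<rhd> \<Gamma> \<turnstile> M \<approx> M' \<Colon> Or A B \<parallel> \<Delta> \<Longrightarrow> T \<rhd> \<Gamma> \<turnstile> Name2 a b M \<approx> Name2 a b M' \<Colon> Bot \<parallel> \<Delta>"
  using cong_Name2 by blast

lemma eq_Name_MuI:
  "b < length \<Delta> \<Longrightarrow> \<Delta> ! b = B \<Longrightarrow> T \<rhd> \<Gamma> \<turnstile> M \<Colon> Bot \<parallel> B # \<Delta> \<Longrightarrow>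
    T \<rhd> \<Gamma> \<turnstile> Name b (Mu B M) \<approx> renc (case_nat b (\<lambda>n. n)) M \<Colon> Bot \<parallel> \<Delta>"
  using eq_Name_Mu by blast

text \<open>Contexts grow at the far end, where indices stay put, so every rule transfers without
  shifts. This is what carries equations between closed functions into arbitrary contexts.\<close>

lemma eqv_append:
  assumes "T \<rhd> \<Gamma> \<turnstile> M \<approx> N \<Colon> A \<parallel> \<Delta>"
  shows "T \<rhd> \<Gamma> @ \<Gamma>' \<turnstile> M \<approx> N \<Colon> A \<parallel> \<Delta> @ \<Delta>'"
  using assms
proof (induction rule: eqv.induct)
  case (eq_eqn \<Gamma> M N A \<Delta> \<Gamma>1 \<Delta>1)
  then show ?case using eqv.eq_eqn[of \<Gamma> M N A \<Delta> T "\<Gamma>1 @ \<Gamma>'" "\<Delta>1 @ \<Delta>'"] by simp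
next
  case (eq_sym \<Gamma> M N A \<Delta>)
  then show ?case by (blast intro: eqv.eq_sym)
next
  case (eq_trans \<Gamma> M N A \<Delta> P)
  then show ?case by (blast intro: eqv.eq_trans)
next
  case (cong_App \<Gamma> M M' B A \<Delta> N N')
  then show ?case by (blast intro: eqv.cong_App)
next
  case (cong_Proj1 \<Gamma> M M' A B \<Delta>)
  then show ?case by (blast intro: eqv.cong_Proj1)
next
  case (cong_Proj2 \<Gamma> M M' A B \<Delta>)
  then show ?case by (blast intro: eqv.cong_Proj2)
next
  case (cong_Name a \<Delta> \<Gamma> M M')
  then show ?case using eqv.cong_Name[of a "\<Delta> @ \<Delta>'"] by (simp add: nth_append)
next
  case (cong_Name2 a1 \<Delta> a2 \<Gamma> M M')
  then show ?case using eqv.cong_Name2[of a1 "\<Delta> @ \<Delta>'" a2] by (simp add: nth_append)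
next
  case (eq_Proj1 \<Gamma> M A \<Delta> N B)
  then show ?case by (blast intro: eqv.eq_Proj1 typed_append)
next
  case (eq_Proj2 \<Gamma> M A \<Delta> N B)
  then show ?case by (blast intro: eqv.eq_Proj2 typed_append)
next
  case (eq_Name_Mu b \<Delta> \<Gamma> M)
  then show ?case
    using eqv.eq_Name_Mu[of b "\<Delta> @ \<Delta>'" T "\<Gamma> @ \<Gamma>'" M] typed_append[OF eq_Name_Mu(2), of \<Gamma>' \<Delta>']
    by (simp add: nth_append)
next
  case (eq_Name2_Mu2 b1 \<Delta> b2 \<Gamma> M)
  then show ?case
    using eqv.eq_Name2_Mu2[of b1 "\<Delta> @ \<Delta>'" b2 T "\<Gamma> @ \<Gamma>'" M]
      typed_append[OF eq_Name2_Mu2(3), of \<Gamma>' \<Delta>']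
    by (simp add: nth_append)
next
  case (eq_Name_Bot b \<Delta> \<Gamma> M)
  then show ?case using eqv.eq_Name_Bot[of b "\<Delta> @ \<Delta>'"] typed_append[OF eq_Name_Bot(3), of \<Gamma>' \<Delta>'] by (simp add: nth_append)
next
  case (eq_Name2_Mu a1 \<Delta> a2 \<Gamma> M)
  then show ?case
    using eqv.eq_Name2_Mu[of a1 "\<Delta> @ \<Delta>'" a2 T "\<Gamma> @ \<Gamma>'" M]
      typed_append[OF eq_Name2_Mu(3), of \<Gamma>' \<Delta>']
    by (simp add: nth_append)
next
  case (eq_beta B \<Gamma> M A \<Delta> N)
  then show ?case using typed_append[OF eq_beta(1)] by (auto intro: eqv.eq_beta typed_append)
next
  case (eq_App_Mu \<Gamma> M B A \<Delta> N)
  then show ?case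
    using typed_append[OF eq_App_Mu(1)] by (auto intro: eqv.eq_App_Mu typed_append)
next
  case (eq_Proj1_Mu \<Gamma> M A B \<Delta>)
  then show ?case using typed_append[OF eq_Proj1_Mu(1)] by (auto intro: eqv.eq_Proj1_Mu)
next
  case (eq_Proj2_Mu \<Gamma> M A B \<Delta>)
  then show ?case using typed_append[OF eq_Proj2_Mu(1)] by (auto intro: eqv.eq_Proj2_Mu)
next
  case (eq_eta \<Gamma> M B A \<Delta>)
  then show ?case by (auto intro: eqv.eq_eta typed_append)
next
  case (eq_Pair \<Gamma> M A B \<Delta>)
  then show ?case by (auto intro: eqv.eq_Pair typed_append)
next
  case (eq_Unit \<Gamma> M \<Delta>)
  then show ?case by (auto intro: eqv.eq_Unit typed_append)
next
  case (eq_Mu_Name \<Gamma> M A \<Delta>)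
  then show ?case by (auto intro: eqv.eq_Mu_Name typed_append)
next
  case (eq_Mu2_Name2 \<Gamma> M A1 A2 \<Delta>)
  then show ?case using eqv.eq_Mu2_Name2[OF typed_append] by simp
next
  case (eq_refl \<Gamma> M A \<Delta>)
  then show ?case by (auto intro: eqv.eq_refl typed_append)
qed (auto intro: cong_Lam cong_Pair cong_Mu cong_Mu2)

text \<open>Additional equations are typed by the requirement on theories; the axioms come down to
  the typing of renaming, substitution and structural substitution.\<close>

lemma eqv_typed:
  assumes lm: "lambda_mu_theory T" and "T \<rhd> \<Gamma> \<turnstile> M \<approx> N \<Colon> A \<parallel> \<Delta>"
  shows "(T \<rhd> \<Gamma> \<turnstile> M \<Colon> A \<parallel> \<Delta>) \<and> (T \<rhd> \<Gamma> \<turnstile> N \<Colon> A \<parallel> \<Delta>)"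
  using assms(2)
proof (induction rule: eqv.induct)
  case (eq_eqn \<Gamma> M N A \<Delta> \<Gamma>' \<Delta>')
  then show ?case using lm by (auto simp: lambda_mu_theory_def intro!: typed_append)
next
  case (eq_beta B \<Gamma> M A \<Delta> N)
  then show ?case by (auto intro: typed_App typed_Lam typed_inst)
next
  case (eq_eta \<Gamma> M B A \<Delta>)
  then show ?case by (auto intro!: typed_Lam typed_App[OF typed_weaken_var] typed_VarI)
next
  case (eq_Name_Mu b \<Delta> \<Gamma> M)
  then show ?case
    by (auto intro!: typed_Name typed_Mu typed_renc[OF eq_Name_Mu(2)] simp: less_Suc_eq_0_disj)
next
  case (eq_Mu_Name \<Gamma> M A \<Delta>)
  then show ?case by (auto intro!: typed_Mu typed_NameI typed_weaken_control)
next
  case (eq_Name2_Mu2 b1 \<Delta> b2 \<Gamma> M)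
  then show ?case
    by (auto intro!: typed_Name2 typed_Mu2 typed_renc[OF eq_Name2_Mu2(3)] simp: less_Suc_eq_0_disj)
next
  case (eq_Mu2_Name2 \<Gamma> M A1 A2 \<Delta>)
  then show ?case by (auto intro!: typed_Mu2 typed_Name2I typed_weaken_control2)
next
  case (eq_App_Mu \<Gamma> M B A \<Delta> N)
  have "T \<rhd> (B \<^bold>\<rightarrow> A) # \<Gamma> \<turnstile> Name 0 (App (Var 0) (renv Suc (renc Suc N))) \<Colon> Bot
    \<parallel> ((B \<^bold>\<rightarrow> A) # \<Delta>)[0 := A]"
    using eq_App_Mu(2)
    by (auto intro!: typed_NameI typed_App[where B = B] typed_VarI typed_weaken_var
        typed_weaken_control)
  from typed_ssub[OF eq_App_Mu(1) _ _ this] eq_App_Mu show ?case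
    by (auto intro!: typed_Mu typed_App[where B = B])
next
  case (eq_Proj1_Mu \<Gamma> M A B \<Delta>)
  have "T \<rhd> Times A B # \<Gamma> \<turnstile> Name 0 (Proj1 (Var 0)) \<Colon> Bot \<parallel> (Times A B # \<Delta>)[0 := A]"
    by (auto intro!: typed_NameI typed_Proj1[where B = B] typed_VarI)
  from typed_ssub[OF eq_Proj1_Mu(1) _ _ this] eq_Proj1_Mu show ?case
    by (auto intro!: typed_Mu typed_Proj1[where B = B])
next
  case (eq_Proj2_Mu \<Gamma> M A B \<Delta>)
  have "T \<rhd> Times A B # \<Gamma> \<turnstile> Name 0 (Proj2 (Var 0)) \<Colon> Bot \<parallel> (Times A B # \<Delta>)[0 := B]"
    by (auto intro!: typed_NameI typed_Proj2[where A = A] typed_VarI)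
  from typed_ssub[OF eq_Proj2_Mu(1) _ _ this] eq_Proj2_Mu show ?case
    by (auto intro!: typed_Mu typed_Proj2[where A = A])
next
  case (eq_Name2_Mu a1 \<Delta> a2 \<Gamma> M)
  let ?B = "Or (\<Delta> ! a1) (\<Delta> ! a2)"
  let ?C = "Name2 (Suc a1) (Suc a2) (Var 0)"
  let ?N = "ssub ?B 0 ?C M"
  \<comment> \<open>\<open>?C\<close> avoids index 0, so the vacated slot may carry any type;
    \<open>Top\<close> is a placeholder.\<close>
  have "T \<rhd> ?B # \<Gamma> \<turnstile> ?C \<Colon> Bot \<parallel> (?B # \<Delta>)[0 := Top]"
    using eq_Name2_Mu by (auto intro!: typed_Name2I typed_VarI)
  from typed_ssub[OF eq_Name2_Mu(3) _ _ this] have N: "T \<rhd> \<Gamma> \<turnstile> ?N \<Colon> Bot \<parallel> Top # \<Delta>"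
    by simp
  have "renc Suc (renc (\<lambda>n. n - 1) ?N) = ?N"
    unfolding renc_renc by (rule renc_ssub_fresh) simp_all
  with N have "T \<rhd> \<Gamma> \<turnstile> renc (\<lambda>n. n - 1) ?N \<Colon> Bot \<parallel> \<Delta>"
    by (metis typed_strengthen_control)
  with eq_Name2_Mu show ?case by (auto intro!: typed_Name2 typed_Mu)
qed (auto intro: typed.intros)

lemma beta_eq:
  "T \<rhd> B # \<Gamma> \<turnstile> M \<Colon> A \<parallel> \<Delta> \<Longrightarrow> T \<rhd> \<Gamma> \<turnstile> N \<Colon> B \<parallel> \<Delta> \<Longrightarrow> inst M N = P \<Longrightarrow>
    T \<rhd> \<Gamma> \<turnstile> App (Lam B M) N \<approx> P \<Colon> A \<parallel> \<Delta>"
  using eq_beta by blast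

text \<open>Naming at \<bot> is the identity, so the eta law for \<mu> turns into the removal of a
  vacuous binder.\<close>

lemma Mu_Bot_eq:
  assumes "T \<rhd> \<Gamma> \<turnstile> M \<Colon> Bot \<parallel> \<Delta>"
  shows "T \<rhd> \<Gamma> \<turnstile> Mu Bot (renc Suc M) \<approx> M \<Colon> Bot \<parallel> \<Delta>"
proof -
  have "T \<rhd> \<Gamma> \<turnstile> Name 0 (renc Suc M) \<approx> renc Suc M \<Colon> Bot \<parallel> Bot # \<Delta>"
    using assms by (intro eq_Name_Bot typed_weaken_control) auto
  from eq_trans[OF eq_sym[OF cong_Mu[OF this]] eq_Mu_Name[OF assms]] show ?thesis .
qed

section \<open>Closed functions\<close>

lemma closed_simps:
  assumes "is_fun T F A B"
  shows "renv f F = F" "renc g F = F" "subst s F = F" "ssub D a C F = F" "inst F N = F"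
  using assms unfolding is_fun_def inst_def
  by (auto intro: renv_fixed renc_fixed subst_fixed ssub_fresh)

lemma typed_closed: "is_fun T F A B \<Longrightarrow> T \<rhd> \<Gamma> \<turnstile> F \<Colon> A \<^bold>\<rightarrow> B \<parallel> \<Delta>"
  unfolding is_fun_def using typed_append[of T "[]" F _ "[]" \<Gamma> \<Delta>] by simp

lemma typed_App_closed:
  "is_fun T F A B \<Longrightarrow> T \<rhd> \<Gamma> \<turnstile> N \<Colon> A \<parallel> \<Delta> \<Longrightarrow> T \<rhd> \<Gamma> \<turnstile> App F N \<Colon> B \<parallel> \<Delta>"
  by (rule typed_App[OF typed_closed])

lemma cong_App_closed:
  "is_fun T F A B \<Longrightarrow> T \<rhd> \<Gamma> \<turnstile> N \<approx> N' \<Colon> A \<parallel> \<Delta> \<Longrightarrow> T \<rhd> \<Gamma> \<turnstile> App F N \<approx> App F N' \<Colon> B \<parallel> \<Delta>"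
  by (rule cong_App[OF eq_refl[OF typed_closed]])

lemma fun_eq_App:
  assumes "fun_eq T A B F G" and "T \<rhd> \<Gamma> \<turnstile> N \<Colon> A \<parallel> \<Delta>"
  shows "T \<rhd> \<Gamma> \<turnstile> App F N \<approx> App G N \<Colon> B \<parallel> \<Delta>"
  using assms eqv_append[of T "[]" F G _ "[]" \<Gamma> \<Delta>]
  unfolding fun_eq_def by (auto intro: cong_App eq_refl)

text \<open>Extensionality from eta: agreement on a generic argument is abstracted on both sides.
  \<open>fun_eqI2\<close> does this with a second argument when the target is a function
  type.\<close>

lemma fun_eqI:
  assumes F: "is_fun T F A B" and G: "is_fun T G A B"
    and eq: "T \<rhd> [A] \<turnstile> App F (Var 0) \<approx> App G (Var 0) \<Colon> B \<parallel> []"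
  shows "fun_eq T A B F G"
proof -
  have eta: "T \<rhd> [] \<turnstile> Lam A (App F' (Var 0)) \<approx> F' \<Colon> A \<^bold>\<rightarrow> B \<parallel> []" if "is_fun T F' A B" for F'
    using eq_eta[of T "[]" F' A B "[]"] that by (simp add: closed_simps[OF that] is_fun_def)
  show ?thesis unfolding fun_eq_def
    using eq_trans[OF eq_sym[OF eta[OF F]] eq_trans[OF cong_Lam[OF eq] eta[OF G]]] .
qed

lemma fun_eqI2:
  assumes F: "is_fun T F A (B \<^bold>\<rightarrow> D)" and G: "is_fun T G A (B \<^bold>\<rightarrow> D)"
    and eq: "T \<rhd> [B, A] \<turnstile> App (App F (Var 1)) (Var 0) \<approx> App (App G (Var 1)) (Var 0) \<Colon> D \<parallel> []"
  shows "fun_eq T A (B \<^bold>\<rightarrow> D) F G"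
proof (rule fun_eqI[OF F G])
  have eta: "T \<rhd> [A] \<turnstile> Lam B (App (App F' (Var 1)) (Var 0)) \<approx> App F' (Var 0) \<Colon> B \<^bold>\<rightarrow> D \<parallel> []"
    if "is_fun T F' A (B \<^bold>\<rightarrow> D)" for F'
    using eq_eta[of T "[A]" "App F' (Var 0)" B D "[]"] typed_App_closed[OF that, of "[A]" "Var 0" "[]"]
    by (simp add: closed_simps[OF that] typed_VarI)
  show "T \<rhd> [A] \<turnstile> App F (Var 0) \<approx> App G (Var 0) \<Colon> B \<^bold>\<rightarrow> D \<parallel> []"
    using eq_trans[OF eq_sym[OF eta[OF F]] eq_trans[OF cong_Lam[OF eq] eta[OF G]]] .
qed

lemma is_fun_comp:
  assumes "is_fun T F A B" and "is_fun T G B D"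
  shows "is_fun T (comp_fun A G F) A D"
  unfolding comp_fun_def closed_simps[OF assms(1)] closed_simps[OF assms(2)]
  unfolding is_fun_def[of T "Lam _ _"]
  by (intro typed_Lam typed_App_closed[OF assms(2)] typed_App_closed[OF assms(1)] typed_VarI) simp_all

lemma comp_fun_App:
  assumes "is_fun T F A B" and "is_fun T G B D" and "T \<rhd> \<Gamma> \<turnstile> N \<Colon> A \<parallel> \<Delta>"
  shows "T \<rhd> \<Gamma> \<turnstile> App (comp_fun A G F) N \<approx> App G (App F N) \<Colon> D \<parallel> \<Delta>"
  unfolding comp_fun_def closed_simps[OF assms(1)] closed_simps[OF assms(2)]
  by (intro beta_eq typed_App_closed[OF assms(2)] typed_App_closed[OF assms(1)] typed_VarI assms(3))
    (simp_all add: closed_simps[OF assms(1)] closed_simps[OF assms(2)])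

text \<open>Wrapping both sides as closed functions and applying them to \<open>N\<close>
  instantiates an equation about a variable at any term in any context. This stands in for closure
  of derivable equality under substitution.\<close>

lemma eqv_App_App:
  assumes fs: "is_fun T F A B" "is_fun T G B D" "is_fun T F' A B'" "is_fun T G' B' D"
    and eq: "T \<rhd> [A] \<turnstile> App G (App F (Var 0)) \<approx> App G' (App F' (Var 0)) \<Colon> D \<parallel> []"
    and N: "T \<rhd> \<Gamma> \<turnstile> N \<Colon> A \<parallel> \<Delta>"
  shows "T \<rhd> \<Gamma> \<turnstile> App G (App F N) \<approx> App G' (App F' N) \<Colon> D \<parallel> \<Delta>"
proof -
  have V: "T \<rhd> [A] \<turnstile> Var 0 \<Colon> A \<parallel> []"
    by (simp add: typed_VarI)
  have "fun_eq T A D (comp_fun A G F) (comp_fun A G' F')"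
    by (intro fun_eqI is_fun_comp[OF fs(1,2)] is_fun_comp[OF fs(3,4)]
        eq_trans[OF comp_fun_App[OF fs(1,2) V] eq_trans[OF eq eq_sym[OF comp_fun_App[OF fs(3,4) V]]]])
  from eq_trans[OF eq_sym[OF comp_fun_App[OF fs(1,2) N]]
      eq_trans[OF fun_eq_App[OF this N] comp_fun_App[OF fs(3,4) N]]]
  show ?thesis .
qed

lemma is_fun_id: "is_fun T (id_fun A) A A"
  unfolding is_fun_def id_fun_def by (auto intro!: typed_Lam typed_VarI)

lemma id_fun_App: "T \<rhd> \<Gamma> \<turnstile> N \<Colon> A \<parallel> \<Delta> \<Longrightarrow> T \<rhd> \<Gamma> \<turnstile> App (id_fun A) N \<approx> N \<Colon> A \<parallel> \<Delta>"
  unfolding id_fun_def by (intro beta_eq typed_VarI) simp_all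

lemma is_fun_neg:
  assumes "is_fun T F B A"
  shows "is_fun T (neg_fun B A F) (Neg A) (Neg B)"
  unfolding neg_fun_def closed_simps[OF assms]
  unfolding is_fun_def[of T "Lam _ _"]
  by (intro typed_Lam typed_App[where B = A] typed_App_closed[OF assms] typed_VarI) simp_all

lemma neg_fun_Lam:
  assumes F: "is_fun T F B A" and K: "T \<rhd> \<Gamma> \<turnstile> K \<Colon> Neg A \<parallel> \<Delta>"
  shows "T \<rhd> \<Gamma> \<turnstile> App (neg_fun B A F) K \<approx> Lam B (App (renv Suc K) (App F (Var 0))) \<Colon> Neg B \<parallel> \<Delta>"
  unfolding neg_fun_def closed_simps[OF F]
  by (intro beta_eq typed_Lam typed_App[where B = A] typed_App_closed[OF F] typed_VarI K)
    (simp_all add: inst_def closed_simps[OF F])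

lemma neg_fun_App:
  assumes F: "is_fun T F B A" and K: "T \<rhd> \<Gamma> \<turnstile> K \<Colon> Neg A \<parallel> \<Delta>" and N: "T \<rhd> \<Gamma> \<turnstile> N \<Colon> B \<parallel> \<Delta>"
  shows "T \<rhd> \<Gamma> \<turnstile> App (App (neg_fun B A F) K) N \<approx> App K (App F N) \<Colon> Bot \<parallel> \<Delta>"
proof -
  have "T \<rhd> \<Gamma> \<turnstile> App (Lam B (App (renv Suc K) (App F (Var 0)))) N \<approx> App K (App F N) \<Colon> Bot \<parallel> \<Delta>"
    by (intro beta_eq typed_App[OF typed_weaken_var[OF K]] typed_App_closed[OF F] typed_VarI N)
      (simp_all add: closed_simps[OF F])
  from eq_trans[OF cong_App[OF neg_fun_Lam[OF F K] eq_refl[OF N]] this] show ?thesis .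
qed

section \<open>Structural substitution\<close>

text \<open>Both instances are beta-reducts of the same abstraction, applied to equal
  arguments.\<close>

lemma eqv_inst:
  assumes lm: "lambda_mu_theory T" and M: "T \<rhd> B # \<Gamma> \<turnstile> M \<Colon> A \<parallel> \<Delta>" and N: "T \<rhd> \<Gamma> \<turnstile> N \<approx> N' \<Colon> B \<parallel> \<Delta>"
  shows "T \<rhd> \<Gamma> \<turnstile> inst M N \<approx> inst M N' \<Colon> A \<parallel> \<Delta>"
proof -
  have "T \<rhd> \<Gamma> \<turnstile> App (Lam B M) N \<approx> App (Lam B M) N' \<Colon> A \<parallel> \<Delta>"
    using N by (intro cong_App[OF eq_refl[OF typed_Lam[OF M]]])
  then show ?thesis
    using eq_beta[OF M] eqv_typed[OF lm N] by (blast intro: eq_trans eq_sym)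
qed

lemma one_hole_simps:
  assumes "T \<rhd> [B] \<turnstile> E \<Colon> A \<parallel> []"
  shows "renc g E = E" "renv (up f) E = E" "subst (case_nat (Var 0) s) E = E"
  using assms by (auto intro: renc_fixed renv_fixed subst_fixed)

text \<open>With \<open>h\<close> the variable \<open>n\<close>, filling \<lambda>x. a E for
  \<open>h\<close> commutes with the replacement of \<open>a\<close> by h applied to the hole. As
  \<open>s\<close> undoes \<open>r\<close>, the rest of \<open>M\<close> is unaffected. The
  generality in \<open>n\<close>, \<open>s\<close>, \<open>r\<close> and \<open>a\<close> is what
  the induction needs under binders.\<close>

lemma subst_ssub_App_hole:
  assumes E: "T \<rhd> [B] \<turnstile> E \<Colon> A \<parallel> []"
    and "s n = Lam B (Name a E)" and "\<And>i. s (r i) = Var i"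
  shows "subst s (ssub B a (App (Var (Suc n)) (Var 0)) (renv r M))
    = ssub B a (App (Lam B (Name a E)) (Var 0)) M"
  using assms(2,3)
proof (induction M arbitrary: n s r a)
  case (Lam D M)
  let ?s = "case_nat (Var 0) (\<lambda>n. renv Suc (s n))"
  have "?s (Suc n) = Lam B (Name a E)"
    using Lam.prems by (simp add: one_hole_simps[OF E])
  moreover have "?s (up r i) = Var i" for i
    using Lam.prems by (cases i) simp_all
  ultimately show ?case using Lam.IH[of ?s "Suc n" a "up r"] by (simp add: one_hole_simps[OF E])
next
  case (Mu D M)
  then show ?case by (simp add: one_hole_simps[OF E])
next
  case (Mu2 D1 D2 M)
  then show ?case by (simp add: one_hole_simps[OF E])
next
  case (Name b M)
  then show ?case by (auto simp: inst_def one_hole_simps[OF E])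
next
  case (Name2 b1 b2 M)
  then show ?case by (auto simp: inst_def one_hole_simps[OF E] simp flip: renc_subst)
qed simp_all

text \<open>
  In \<open>ssub_beta\<close>, \<open>E\<close> is a one-hole context, and \<open>\<Delta>[a := A]\<close> reflects that the index \<open>a\<close> is reused for
  the new control variable of type \<open>A\<close>.
\<close>

lemma ssub_beta:
  assumes lm: "lambda_mu_theory T" and E: "T \<rhd> [B] \<turnstile> E \<Colon> A \<parallel> []"
    and "T \<rhd> \<Gamma> \<turnstile> M \<Colon> D \<parallel> \<Delta>" and "a < length \<Delta>" and "\<Delta> ! a = B"
  shows "T \<rhd> \<Gamma> \<turnstile> ssub B a (App (Lam B (Name a E)) (Var 0)) M \<approx> ssub B a (Name a E) M \<Colon> D
    \<parallel> \<Delta>[a := A]"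
proof -
  \<comment> \<open>The beta step at a single replaced occurrence, whose argument \<open>P\<close>
    has itself already been rewritten to \<open>P'\<close>.\<close>
  have fill: "T \<rhd> \<Gamma> \<turnstile> inst (App (Lam B (Name a E)) (Var 0)) P \<approx> inst (Name a E) P' \<Colon> Bot \<parallel> \<Delta>"
    if P: "T \<rhd> \<Gamma> \<turnstile> P \<approx> P' \<Colon> B \<parallel> \<Delta>" and a: "a < length \<Delta>" "\<Delta> ! a = A" for \<Gamma> \<Delta> a P P'
  proof -
    have "T \<rhd> B # \<Gamma> \<turnstile> E \<Colon> A \<parallel> \<Delta>"
      using typed_append[OF E, of \<Gamma> \<Delta>] by simp
    with a have aE: "T \<rhd> B # \<Gamma> \<turnstile> Name a E \<Colon> Bot \<parallel> \<Delta>"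
      by (blast intro: typed_NameI)
    have "inst (App (Lam B (Name a E)) (Var 0)) P = App (Lam B (Name a E)) P"
      by (simp add: inst_def one_hole_simps[OF E])
    then show ?thesis
      using eq_trans[OF eq_beta[OF aE] eqv_inst[OF lm aE P]] eqv_typed[OF lm P] by simp
  qed
  show ?thesis
    using assms(3-)
  proof (induction arbitrary: a rule: typed.induct)
    case (typed_Lam D' \<Gamma> M D \<Delta>)
    then show ?case by (auto simp: one_hole_simps[OF E] intro!: cong_Lam)
  next
    case (typed_Mu \<Gamma> M D \<Delta>)
    then show ?case using typed_Mu.IH[of "Suc a"] by (auto simp: one_hole_simps[OF E] intro!: cong_Mu)
  next
    case (typed_Mu2 \<Gamma> M D1 D2 \<Delta>)
    then show ?case
      using typed_Mu2.IH[of "Suc (Suc a)"] by (auto simp: one_hole_simps[OF E] intro!: cong_Mu2)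
  next
    case (typed_App \<Gamma> M D' D \<Delta> N)
    show ?case using typed_App.IH[OF typed_App.prems] by (auto intro: cong_App)
  next
    case (typed_Name b \<Delta> \<Gamma> M)
    have IH: "T \<rhd> \<Gamma> \<turnstile> ssub B a (App (Lam B (Name a E)) (Var 0)) M \<approx> ssub B a (Name a E) M
      \<Colon> \<Delta> ! b \<parallel> \<Delta>[a := A]"
      using typed_Name by blast
    show ?case
    proof (cases "b = a")
      case True
      then show ?thesis using fill[OF IH[unfolded True typed_Name.prems(2)]] typed_Name.prems by simp
    next
      case False
      then show ?thesis using IH typed_Name.hyps by (auto intro!: cong_NameI)
    qed
  next
    case (typed_Name2 b1 \<Delta> b2 \<Gamma> M)
    let ?x = "if b1 = a then 0 else Suc b1" and ?y = "if b2 = a then 0 else Suc b2"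
    have IH: "T \<rhd> \<Gamma> \<turnstile> ssub B a (App (Lam B (Name a E)) (Var 0)) M \<approx> ssub B a (Name a E) M
      \<Colon> Or (\<Delta> ! b1) (\<Delta> ! b2) \<parallel> \<Delta>[a := A]"
      using typed_Name2 by blast
    show ?case
    proof (cases "b1 = a \<or> b2 = a")
      case True
      \<comment> \<open>Seen as a one-hole term, the wrapper \<open>Mu B (Name2 ...)\<close> lets
        \<open>eqv_inst\<close> carry the induction hypothesis below the binder.\<close>
      have "T \<rhd> Or (\<Delta> ! b1) (\<Delta> ! b2) # \<Gamma> \<turnstile> Mu B (Name2 ?x ?y (Var 0)) \<Colon> B \<parallel> \<Delta>[a := A]"
        using typed_Name2.hyps typed_Name2.prems by (auto intro!: typed_Mu typed_Name2I typed_VarI)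
      from fill[OF eqv_inst[OF lm this IH], of a] True typed_Name2.prems show ?thesis by simp
    next
      case False
      then show ?thesis using IH typed_Name2.hyps by (auto intro!: cong_Name2I)
    qed
  qed (auto intro!: eq_refl cong_Pair intro: cong_Proj1 cong_Proj2 typed.intros)
qed

text \<open>Replacing \<open>a\<close> by itself changes a term only in the \<open>Name2\<close>
  clause, where a \<mu>-abstraction is inserted directly under the name \<open>a\<close>; the rule
  \<open>eq_Name_Mu\<close> contracts it again.\<close>

lemma ssub_Name_hole:
  assumes lm: "lambda_mu_theory T"
    and "T \<rhd> \<Gamma> \<turnstile> M \<Colon> D \<parallel> \<Delta>" and "a < length \<Delta>" and "\<Delta> ! a = B"
  shows "T \<rhd> \<Gamma> \<turnstile> ssub B a (Name a (Var 0)) M \<approx> M \<Colon> D \<parallel> \<Delta>"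
  using assms(2-)
proof (induction arbitrary: a rule: typed.induct)
  case (typed_Mu \<Gamma> M D \<Delta>)
  then show ?case using typed_Mu.IH[of "Suc a"] by (auto intro!: cong_Mu)
next
  case (typed_Mu2 \<Gamma> M D1 D2 \<Delta>)
  then show ?case using typed_Mu2.IH[of "Suc (Suc a)"] by (auto intro!: cong_Mu2)
next
  case (typed_App \<Gamma> M D' D \<Delta> N)
  show ?case using typed_App.IH[OF typed_App.prems] by (auto intro: cong_App)
next
  case (typed_Name b \<Delta> \<Gamma> M)
  then show ?case by (auto intro!: cong_Name)
next
  case (typed_Name2 b1 \<Delta> b2 \<Gamma> M)
  let ?x = "if b1 = a then 0 else Suc b1" and ?y = "if b2 = a then 0 else Suc b2"
  let ?N = "ssub B a (Name a (Var 0)) M"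
  have IH: "T \<rhd> \<Gamma> \<turnstile> ?N \<approx> M \<Colon> Or (\<Delta> ! b1) (\<Delta> ! b2) \<parallel> \<Delta>"
    using typed_Name2 by blast
  then have "T \<rhd> \<Gamma> \<turnstile> Name2 ?x ?y (renc Suc ?N) \<Colon> Bot \<parallel> B # \<Delta>"
    using eqv_typed[OF lm IH] typed_Name2.hyps typed_Name2.prems
    by (intro typed_Name2I[OF _ _ _ _ typed_weaken_control]) auto
  from eq_Name_MuI[OF typed_Name2.prems this]
  have "T \<rhd> \<Gamma> \<turnstile> Name a (Mu B (Name2 ?x ?y (renc Suc ?N))) \<approx> Name2 b1 b2 ?N \<Colon> Bot \<parallel> \<Delta>"
    by (simp add: renc_renc split: if_splits)
  with cong_Name2[OF typed_Name2.hyps(1,2) IH] show ?case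
    by (auto intro: eq_trans)
qed (auto intro!: eq_refl cong_Pair cong_Lam intro: cong_Proj1 cong_Proj2 typed.intros)

section \<open>Focal functions\<close>

definition eps :: "'t ty \<Rightarrow> ('t, 'c) trm" where
  "eps A = Lam (Neg (Neg A)) (Mu A (App (Var 0) (Lam A (Name 0 (Var 0)))))"

definition eta :: "'t ty \<Rightarrow> ('t, 'c) trm" where
  "eta A = Lam A (Lam (Neg A) (App (Var 0) (Var 1)))"

abbreviation dneg_fun :: "'t ty \<Rightarrow> 't ty \<Rightarrow> ('t, 'c) trm \<Rightarrow> ('t, 'c) trm" where
  "dneg_fun B A F \<equiv> neg_fun (Neg A) (Neg B) (neg_fun B A F)"

lemma typed_Lam_Name: "T \<rhd> \<Gamma> \<turnstile> Lam A (Name 0 (Var 0)) \<Colon> Neg A \<parallel> A # \<Delta>"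
  by (auto intro!: typed_Lam typed_NameI typed_VarI)

lemma is_fun_eps: "is_fun T (eps A) (Neg (Neg A)) A"
  unfolding is_fun_def eps_def
  by (intro typed_Lam typed_Mu typed_App[OF _ typed_Lam_Name] typed_VarI) simp_all

lemma eps_App:
  assumes "T \<rhd> \<Gamma> \<turnstile> N \<Colon> Neg (Neg A) \<parallel> \<Delta>"
  shows "T \<rhd> \<Gamma> \<turnstile> App (eps A) N \<approx> Mu A (App (renc Suc N) (Lam A (Name 0 (Var 0)))) \<Colon> A \<parallel> \<Delta>"
  unfolding eps_def
  by (intro beta_eq typed_Mu typed_App[OF _ typed_Lam_Name] typed_VarI assms)
    (simp_all add: inst_def)

lemma is_fun_eta: "is_fun T (eta A) A (Neg (Neg A))"
  unfolding is_fun_def eta_def by (intro typed_Lam typed_App[where B = A] typed_VarI) simp_all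

lemma eta_App:
  assumes N: "T \<rhd> \<Gamma> \<turnstile> N \<Colon> A \<parallel> \<Delta>" and K: "T \<rhd> \<Gamma> \<turnstile> K \<Colon> Neg A \<parallel> \<Delta>"
  shows "T \<rhd> \<Gamma> \<turnstile> App (App (eta A) N) K \<approx> App K N \<Colon> Bot \<parallel> \<Delta>"
proof -
  have "T \<rhd> \<Gamma> \<turnstile> App (eta A) N \<approx> Lam (Neg A) (App (Var 0) (renv Suc N)) \<Colon> Neg (Neg A) \<parallel> \<Delta>"
    unfolding eta_def
    by (intro beta_eq typed_Lam typed_App[where B = A] typed_VarI N) (simp_all add: inst_def)
  moreover have "T \<rhd> \<Gamma> \<turnstile> App (Lam (Neg A) (App (Var 0) (renv Suc N))) K \<approx> App K N \<Colon> Bot \<parallel> \<Delta>"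
    by (intro beta_eq typed_App[OF _ typed_weaken_var[OF N]] typed_VarI K) simp_all
  ultimately show ?thesis
    using K by (blast intro: eq_trans cong_App eq_refl)
qed

lemma eps_neg_App:
  assumes G: "is_fun T G (Neg A) B" and N: "T \<rhd> \<Gamma> \<turnstile> N \<Colon> Neg B \<parallel> \<Delta>"
  shows "T \<rhd> \<Gamma> \<turnstile> App (eps A) (App (neg_fun (Neg A) B G) N)
    \<approx> Mu A (App (renc Suc N) (App G (Lam A (Name 0 (Var 0))))) \<Colon> A \<parallel> \<Delta>"
proof -
  have "T \<rhd> \<Gamma> \<turnstile> App (neg_fun (Neg A) B G) N \<Colon> Neg (Neg A) \<parallel> \<Delta>"
    using G N by (blast intro: typed_App_closed is_fun_neg)
  from eps_App[OF this] have "T \<rhd> \<Gamma> \<turnstile> App (eps A) (App (neg_fun (Neg A) B G) N)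
    \<approx> Mu A (App (App (neg_fun (Neg A) B G) (renc Suc N)) (Lam A (Name 0 (Var 0)))) \<Colon> A \<parallel> \<Delta>"
    by (simp add: closed_simps[OF is_fun_neg[OF G]])
  from eq_trans[OF this cong_Mu[OF neg_fun_App[OF G typed_weaken_control[OF N] typed_Lam_Name]]]
  show ?thesis .
qed

lemma neg_Lam_Name:
  assumes F: "is_fun T F B A"
  shows "T \<rhd> \<Gamma> \<turnstile> App (neg_fun B A F) (Lam A (Name 0 (Var 0))) \<approx> Lam B (Name 0 (App F (Var 0)))
    \<Colon> Neg B \<parallel> A # \<Delta>"
proof -
  have "T \<rhd> B # \<Gamma> \<turnstile> App (Lam A (Name 0 (Var 0))) (App F (Var 0)) \<approx> Name 0 (App F (Var 0)) \<Colon> Bot \<parallel> A # \<Delta>"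
    by (intro beta_eq typed_NameI[where A = A] typed_VarI typed_App_closed[OF F]) simp_all
  from eq_trans[OF neg_fun_Lam[OF F typed_Lam_Name] cong_Lam] this show ?thesis by simp
qed

text \<open>The result has the shape of the right-hand side of the focality equation for k
  (\<lambda>x. a x), the body of \<open>eps\<close>, with \<open>N\<close> in the role of k.\<close>

lemma eps_dneg_App:
  assumes F: "is_fun T F B A" and N: "T \<rhd> \<Gamma> \<turnstile> N \<Colon> Neg (Neg B) \<parallel> \<Delta>"
  shows "T \<rhd> \<Gamma> \<turnstile> App (eps A) (App (dneg_fun B A F) N)
    \<approx> Mu A (App (renc Suc N) (Lam B (Name 0 (App F (Var 0))))) \<Colon> A \<parallel> \<Delta>"
  by (rule eq_trans[OF eps_neg_App[OF is_fun_neg[OF F] N]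
      cong_Mu[OF cong_App[OF eq_refl[OF typed_weaken_control[OF N]] neg_Lam_Name[OF F]]]])

section \<open>Focality as naturality of \<open>eps\<close>\<close>

context
  fixes T :: "('t, 'c) lmtheory"
  assumes lm: "lambda_mu_theory T"
begin

lemma fun_eq_is_fun:
  assumes "fun_eq T A B F G"
  shows "is_fun T F A B" "is_fun T G A B"
  using assms eqv_typed[OF lm] unfolding fun_eq_def is_fun_def by blast+

text \<open>Focality is used at one term only, the body of \<open>eps\<close> with a variable for k.
  The resulting equation is then instantiated by \<open>eqv_App_App\<close>.\<close>

lemma focal_natural:
  assumes F: "focal T F B A" and N: "T \<rhd> \<Gamma> \<turnstile> N \<Colon> Neg (Neg B) \<parallel> \<Delta>"
  shows "T \<rhd> \<Gamma> \<turnstile> App F (App (eps B) N) \<approx> App (eps A) (App (dneg_fun B A F) N) \<Colon> A \<parallel> \<Delta>"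
proof -
  have fF: "is_fun T F B A"
    using F by (simp add: focal_def)
  have "T \<rhd> [Neg (Neg B)] \<turnstile> App (Var 0) (Lam B (Name 0 (Var 0))) \<Colon> Bot \<parallel> [B]"
    by (intro typed_App[OF _ typed_Lam_Name] typed_VarI) simp_all
  then have "T \<rhd> [Neg (Neg B)] \<turnstile> App F (Mu B (App (Var 0) (Lam B (Name 0 (Var 0)))))
    \<approx> Mu A (App (Var 0) (Lam B (Name 0 (App F (Var 0))))) \<Colon> A \<parallel> []"
    using F unfolding focal_def by (fastforce simp: closed_simps[OF fF])
  moreover have V: "T \<rhd> [Neg (Neg B)] \<turnstile> Var 0 \<Colon> Neg (Neg B) \<parallel> []"
    by (simp add: typed_VarI)
  ultimately have eq: "T \<rhd> [Neg (Neg B)] \<turnstile> App F (App (eps B) (Var 0))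
    \<approx> App (eps A) (App (dneg_fun B A F) (Var 0)) \<Colon> A \<parallel> []"
    using cong_App_closed[OF fF eps_App[OF V]] eps_dneg_App[OF fF V]
    by (auto intro: eq_trans eq_sym)
  note fs = fF is_fun_eps[of T A] is_fun_eps[of T B] is_fun_neg[OF is_fun_neg[OF fF]]
  show ?thesis
    by (rule eqv_App_App[OF fs(3,1,4,2) eq N])
qed

text \<open>One \<open>K\<close> serves every one-hole term \<open>E\<close>: the bare hole gives
  back \<open>M\<close>, so that \<open>Mu B M\<close> is \<open>eps\<close> at \<open>K\<close>,
  while F applied to the hole gives the right-hand side of focality.\<close>

lemma Mu_eq_eps:
  assumes M: "T \<rhd> \<Gamma> \<turnstile> M \<Colon> Bot \<parallel> B # \<Delta>"
  obtains K where "T \<rhd> \<Gamma> \<turnstile> K \<Colon> Neg (Neg B) \<parallel> \<Delta>"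
    and "\<And>E A. T \<rhd> [B] \<turnstile> E \<Colon> A \<parallel> [] \<Longrightarrow>
      T \<rhd> \<Gamma> \<turnstile> App (renc Suc K) (Lam B (Name 0 E)) \<approx> ssub B 0 (Name 0 E) M \<Colon> Bot \<parallel> A # \<Delta>"
proof -
  \<comment> \<open>\<open>K = \<lambda>h. M[a\<box> := h \<box>]\<close>; index 0 no longer occurs in \<open>?M\<close>, so the others can be shifted down.\<close>
  let ?M = "ssub B 0 (App (Var 1) (Var 0)) (renv Suc M)"
  let ?K = "Lam (Neg B) (renc (\<lambda>n. n - 1) ?M)"
  \<comment> \<open>Below the hole the variable h has index 1. Control index 0 disappears, so its
    slot is filled with the placeholder \<open>Top\<close>.\<close>
  have "T \<rhd> B # Neg B # \<Gamma> \<turnstile> App (Var 1) (Var 0) \<Colon> Bot \<parallel> (B # \<Delta>)[0 := Top]"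
    by (intro typed_App[where B = B] typed_VarI) simp_all
  from typed_ssub[OF typed_weaken_var[OF M] _ _ this]
  have tM: "T \<rhd> Neg B # \<Gamma> \<turnstile> ?M \<Colon> Bot \<parallel> Top # \<Delta>" by simp
  have eqM: "renc Suc (renc (\<lambda>n. n - 1) ?M) = ?M"
    unfolding renc_renc by (rule renc_ssub_fresh) simp_all
  have K: "T \<rhd> \<Gamma> \<turnstile> ?K \<Colon> Neg (Neg B) \<parallel> \<Delta>"
    using tM eqM by (metis typed_Lam typed_strengthen_control)
  have "T \<rhd> \<Gamma> \<turnstile> App (renc Suc ?K) (Lam B (Name 0 E)) \<approx> ssub B 0 (Name 0 E) M \<Colon> Bot \<parallel> A # \<Delta>"
    if E: "T \<rhd> [B] \<turnstile> E \<Colon> A \<parallel> []" for E A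
  proof -
    have "T \<rhd> B # \<Gamma> \<turnstile> E \<Colon> A \<parallel> A # \<Delta>"
      using typed_append[OF E, of \<Gamma> "A # \<Delta>"] by simp
    then have h: "T \<rhd> \<Gamma> \<turnstile> Lam B (Name 0 E) \<Colon> Neg B \<parallel> A # \<Delta>"
      by (intro typed_Lam typed_NameI) simp_all
    have "inst ?M (Lam B (Name 0 E)) = ssub B 0 (App (Lam B (Name 0 E)) (Var 0)) M"
      unfolding inst_def
      using subst_ssub_App_hole[OF E, of "case_nat (Lam B (Name 0 E)) Var" 0 0 Suc M] by simp
    moreover have "T \<rhd> Neg B # \<Gamma> \<turnstile> ?M \<Colon> Bot \<parallel> A # \<Delta>"
      using typed_weaken_control[OF typed_strengthen_control] tM eqM by metis
    ultimately have "T \<rhd> \<Gamma> \<turnstile> App (Lam (Neg B) ?M) (Lam B (Name 0 E))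
      \<approx> ssub B 0 (App (Lam B (Name 0 E)) (Var 0)) M \<Colon> Bot \<parallel> A # \<Delta>"
      using h by (intro beta_eq) simp_all
    moreover have "renc Suc ?K = Lam (Neg B) ?M"
      using eqM by simp
    ultimately show ?thesis
      using ssub_beta[OF lm E M, of 0] by (simp only:) (auto intro: eq_trans)
  qed
  with K show ?thesis by (rule that)
qed

text \<open>The converse of \<open>focal_natural\<close>: one equation on a generic argument yields
  the focality equation for all \<open>M\<close>, because every \<mu>-abstraction is an instance of
  \<open>eps\<close>.\<close>

lemma focalI:
  assumes F: "is_fun T F B A"
    and eq: "T \<rhd> [Neg (Neg B)] \<turnstile> App F (App (eps B) (Var 0))
      \<approx> App (eps A) (App (dneg_fun B A F) (Var 0)) \<Colon> A \<parallel> []"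
  shows "focal T F B A"
  unfolding focal_def closed_simps[OF F]
proof (intro conjI allI impI F)
  fix \<Gamma> \<Delta> M
  assume M: "T \<rhd> \<Gamma> \<turnstile> M \<Colon> Bot \<parallel> B # \<Delta>"
  obtain K where K: "T \<rhd> \<Gamma> \<turnstile> K \<Colon> Neg (Neg B) \<parallel> \<Delta>"
    and ssub: "\<And>E A. T \<rhd> [B] \<turnstile> E \<Colon> A \<parallel> [] \<Longrightarrow>
      T \<rhd> \<Gamma> \<turnstile> App (renc Suc K) (Lam B (Name 0 E)) \<approx> ssub B 0 (Name 0 E) M \<Colon> Bot \<parallel> A # \<Delta>"
    using Mu_eq_eps[OF M] by blast
  note fs = F is_fun_eps[of T A] is_fun_eps[of T B] is_fun_neg[OF is_fun_neg[OF F]]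
  have 1: "T \<rhd> \<Gamma> \<turnstile> App F (App (eps B) K) \<approx> App (eps A) (App (dneg_fun B A F) K) \<Colon> A \<parallel> \<Delta>"
    by (rule eqv_App_App[OF fs(3,1,4,2) eq K])
  \<comment> \<open>First choice of \<open>E\<close>: F applied to the hole.\<close>
  have "T \<rhd> [B] \<turnstile> App F (Var 0) \<Colon> A \<parallel> []"
    by (intro typed_App_closed[OF F] typed_VarI) simp_all
  from eq_trans[OF eps_dneg_App[OF F K] cong_Mu[OF ssub[OF this]]]
  have 2: "T \<rhd> \<Gamma> \<turnstile> App (eps A) (App (dneg_fun B A F) K)
    \<approx> Mu A (ssub B 0 (Name 0 (App F (Var 0))) M) \<Colon> A \<parallel> \<Delta>" .
  \<comment> \<open>Second choice of \<open>E\<close>: the bare hole, for which the structural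
    substitution is the identity up to equality.\<close>
  have "T \<rhd> [B] \<turnstile> Var 0 \<Colon> B \<parallel> []"
    by (intro typed_VarI) simp_all
  from eq_trans[OF ssub[OF this] ssub_Name_hole[OF lm M]]
  have "T \<rhd> \<Gamma> \<turnstile> App (renc Suc K) (Lam B (Name 0 (Var 0))) \<approx> M \<Colon> Bot \<parallel> B # \<Delta>" by simp
  from eq_trans[OF eps_App[OF K] cong_Mu[OF this]]
  have "T \<rhd> \<Gamma> \<turnstile> App (eps B) K \<approx> Mu B M \<Colon> B \<parallel> \<Delta>" .
  from eq_trans[OF eq_sym[OF cong_App_closed[OF F this]] eq_trans[OF 1 2]]
  show "T \<rhd> \<Gamma> \<turnstile> App F (Mu B M) \<approx> Mu A (ssub B 0 (Name 0 (App F (Var 0))) M) \<Colon> A \<parallel> \<Delta>" .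
qed

declare eq_trans [trans]

section \<open>Negation as a contravariant functor\<close>

lemma neg_fun_cong:
  assumes eq: "fun_eq T B A F G"
  shows "fun_eq T (Neg A) (Neg B) (neg_fun B A F) (neg_fun B A G)"
proof (rule fun_eqI2)
  note F = fun_eq_is_fun(1)[OF eq] and G = fun_eq_is_fun(2)[OF eq]
  show "is_fun T (neg_fun B A F) (Neg A) (Neg B)" "is_fun T (neg_fun B A G) (Neg A) (Neg B)"
    using F G by (simp_all add: is_fun_neg)
  have K: "T \<rhd> [B, Neg A] \<turnstile> Var 1 \<Colon> Neg A \<parallel> []" and N: "T \<rhd> [B, Neg A] \<turnstile> Var 0 \<Colon> B \<parallel> []"
    by (simp_all add: typed_VarI)
  note neg_fun_App[OF F K N]
  also note cong_App[OF eq_refl[OF K] fun_eq_App[OF eq N]]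
  also note eq_sym[OF neg_fun_App[OF G K N]]
  finally show "T \<rhd> [B, Neg A] \<turnstile> App (App (neg_fun B A F) (Var 1)) (Var 0)
    \<approx> App (App (neg_fun B A G) (Var 1)) (Var 0) \<Colon> Bot \<parallel> []" .
qed

lemma neg_fun_comp:
  assumes F: "is_fun T F A B" and G: "is_fun T G B D"
  shows "fun_eq T (Neg D) (Neg A) (neg_fun A D (comp_fun A G F))
    (comp_fun (Neg D) (neg_fun A B F) (neg_fun B D G))"
proof (rule fun_eqI2)
  note nF = is_fun_neg[OF F] and nG = is_fun_neg[OF G] and GF = is_fun_comp[OF F G]
  show "is_fun T (neg_fun A D (comp_fun A G F)) (Neg D) (Neg A)"
    by (rule is_fun_neg[OF GF])
  show "is_fun T (comp_fun (Neg D) (neg_fun A B F) (neg_fun B D G)) (Neg D) (Neg A)"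
    by (rule is_fun_comp[OF nG nF])
  have K: "T \<rhd> [A, Neg D] \<turnstile> Var 1 \<Colon> Neg D \<parallel> []" and N: "T \<rhd> [A, Neg D] \<turnstile> Var 0 \<Colon> A \<parallel> []"
    by (simp_all add: typed_VarI)
  note neg_fun_App[OF GF K N]
  also note cong_App[OF eq_refl[OF K] comp_fun_App[OF F G N]]
  also note eq_sym[OF neg_fun_App[OF G K typed_App_closed[OF F N]]]
  also note eq_sym[OF neg_fun_App[OF F typed_App_closed[OF nG K] N]]
  also note eq_sym[OF cong_App[OF comp_fun_App[OF nG nF K] eq_refl[OF N]]]
  finally show "T \<rhd> [A, Neg D] \<turnstile> App (App (neg_fun A D (comp_fun A G F)) (Var 1)) (Var 0)
    \<approx> App (App (comp_fun (Neg D) (neg_fun A B F) (neg_fun B D G)) (Var 1)) (Var 0) \<Colon> Bot \<parallel> []" .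
qed

lemma neg_fun_comp_App:
  assumes F: "is_fun T F A B" and G: "is_fun T G B D" and N: "T \<rhd> \<Gamma> \<turnstile> N \<Colon> Neg D \<parallel> \<Delta>"
  shows "T \<rhd> \<Gamma> \<turnstile> App (neg_fun A D (comp_fun A G F)) N
    \<approx> App (neg_fun A B F) (App (neg_fun B D G) N) \<Colon> Neg A \<parallel> \<Delta>"
  by (rule eq_trans[OF fun_eq_App[OF neg_fun_comp[OF F G] N]
      comp_fun_App[OF is_fun_neg[OF G] is_fun_neg[OF F] N]])

lemma neg_fun_id: "fun_eq T (Neg A) (Neg A) (neg_fun A A (id_fun A)) (id_fun (Neg A))"
proof (rule fun_eqI2)
  show "is_fun T (neg_fun A A (id_fun A)) (Neg A) (Neg A)"
    by (rule is_fun_neg[OF is_fun_id])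
  show "is_fun T (id_fun (Neg A)) (Neg A) (Neg A)"
    by (rule is_fun_id)
  have K: "T \<rhd> [A, Neg A] \<turnstile> Var 1 \<Colon> Neg A \<parallel> []" and N: "T \<rhd> [A, Neg A] \<turnstile> Var 0 \<Colon> A \<parallel> []"
    by (simp_all add: typed_VarI)
  note neg_fun_App[OF is_fun_id K N]
  also note cong_App[OF eq_refl[OF K] id_fun_App[OF N]]
  also note eq_sym[OF cong_App[OF id_fun_App[OF K] eq_refl[OF N]]]
  finally show "T \<rhd> [A, Neg A] \<turnstile> App (App (neg_fun A A (id_fun A)) (Var 1)) (Var 0)
    \<approx> App (App (id_fun (Neg A)) (Var 1)) (Var 0) \<Colon> Bot \<parallel> []" .
qed

section \<open>Identities relating \<open>eps\<close> and \<open>eta\<close>\<close>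

lemma eps_eta:
  assumes N: "T \<rhd> \<Gamma> \<turnstile> N \<Colon> A \<parallel> \<Delta>"
  shows "T \<rhd> \<Gamma> \<turnstile> App (eps A) (App (eta A) N) \<approx> N \<Colon> A \<parallel> \<Delta>"
proof -
  have N': "T \<rhd> \<Gamma> \<turnstile> renc Suc N \<Colon> A \<parallel> A # \<Delta>"
    by (rule typed_weaken_control[OF N])
  have beta: "T \<rhd> \<Gamma> \<turnstile> App (Lam A (Name 0 (Var 0))) (renc Suc N) \<approx> Name 0 (renc Suc N) \<Colon> Bot \<parallel> A # \<Delta>"
    by (intro beta_eq typed_NameI[where A = A] typed_VarI N') simp_all
  have "T \<rhd> \<Gamma> \<turnstile> App (eps A) (App (eta A) N)
    \<approx> Mu A (App (App (eta A) (renc Suc N)) (Lam A (Name 0 (Var 0)))) \<Colon> A \<parallel> \<Delta>"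
    using eps_App[OF typed_App_closed[OF is_fun_eta N]]
    by (simp add: closed_simps[OF is_fun_eta[of T A]])
  also note cong_Mu[OF eta_App[OF N' typed_Lam_Name]]
  also note cong_Mu[OF beta]
  also note eq_Mu_Name[OF N]
  finally show ?thesis .
qed

text \<open>Applying a \<mu>-abstraction of negated type moves the argument inside and leaves a
  \<mu> at \<bot>, where names and the binder vanish. Hence \<open>eps\<close> at a negation can be
  calculated with through \<open>eta\<close> and functoriality alone.\<close>

lemma eps_Neg: "fun_eq T (Neg (Neg (Neg B))) (Neg B) (eps (Neg B)) (neg_fun B (Neg (Neg B)) (eta B))"
proof (rule fun_eqI2)
  let ?\<Gamma> = "[B, Neg (Neg (Neg B))]"
  show "is_fun T (eps (Neg B)) (Neg (Neg (Neg B))) (Neg B)"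
    by (rule is_fun_eps)
  show "is_fun T (neg_fun B (Neg (Neg B)) (eta B)) (Neg (Neg (Neg B))) (Neg B)"
    by (rule is_fun_neg[OF is_fun_eta])
  have K: "T \<rhd> ?\<Gamma> \<turnstile> Var 1 \<Colon> Neg (Neg (Neg B)) \<parallel> \<Delta>" and N: "T \<rhd> ?\<Gamma> \<turnstile> Var 0 \<Colon> B \<parallel> \<Delta>" for \<Delta>
    by (simp_all add: typed_VarI)
  have "T \<rhd> ?\<Gamma> \<turnstile> App (Var 1) (Lam (Neg B) (Name 0 (Var 0))) \<Colon> Bot \<parallel> [Neg B]"
    by (intro typed_App[OF K typed_Lam_Name])
  from eq_App_Mu[OF this N]
  have App_Mu: "T \<rhd> ?\<Gamma> \<turnstile> App (Mu (Neg B) (App (Var 1) (Lam (Neg B) (Name 0 (Var 0))))) (Var 0)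
    \<approx> Mu Bot (App (Var 1) (Lam (Neg B) (Name 0 (App (Var 0) (Var 1))))) \<Colon> Bot \<parallel> []"
    by simp
  have body: "T \<rhd> Neg B # ?\<Gamma> \<turnstile> App (Var 0) (Var 1) \<Colon> Bot \<parallel> \<Delta>" for \<Delta>
    by (intro typed_App[where B = B] typed_VarI) simp_all
  \<comment> \<open>The control variable now has type \<bot>, so naming it has no effect.\<close>
  have drop: "T \<rhd> ?\<Gamma> \<turnstile> App (Var 1) (Lam (Neg B) (Name 0 (App (Var 0) (Var 1))))
    \<approx> App (Var 1) (Lam (Neg B) (App (Var 0) (Var 1))) \<Colon> Bot \<parallel> [Bot]"
    by (intro cong_App[OF eq_refl[OF K]] cong_Lam eq_Name_Bot body) simp_all
  have "T \<rhd> ?\<Gamma> \<turnstile> App (Var 1) (Lam (Neg B) (App (Var 0) (Var 1))) \<Colon> Bot \<parallel> []"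
    by (intro typed_App[OF K] typed_Lam body)
  from Mu_Bot_eq[OF this] have Mu_Bot:
    "T \<rhd> ?\<Gamma> \<turnstile> Mu Bot (App (Var 1) (Lam (Neg B) (App (Var 0) (Var 1))))
      \<approx> App (Var 1) (Lam (Neg B) (App (Var 0) (Var 1))) \<Colon> Bot \<parallel> []" by simp
  have eta: "T \<rhd> ?\<Gamma> \<turnstile> App (eta B) (Var 0) \<approx> Lam (Neg B) (App (Var 0) (Var 1)) \<Colon> Neg (Neg B) \<parallel> []"
    unfolding eta_def
    by (intro beta_eq typed_Lam typed_App[where B = B] typed_VarI N) (simp_all add: inst_def)
  have "T \<rhd> ?\<Gamma> \<turnstile> App (eps (Neg B)) (Var 1)
    \<approx> Mu (Neg B) (App (Var 1) (Lam (Neg B) (Name 0 (Var 0)))) \<Colon> Neg B \<parallel> []"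
    using eps_App[OF K] by simp
  note cong_App[OF this eq_refl[OF N]]
  also note App_Mu
  also note cong_Mu[OF drop]
  also note Mu_Bot
  also note eq_sym[OF cong_App[OF eq_refl[OF K] eta]]
  also note eq_sym[OF neg_fun_App[OF is_fun_eta K N]]
  finally show "T \<rhd> ?\<Gamma> \<turnstile> App (App (eps (Neg B)) (Var 1)) (Var 0)
    \<approx> App (App (neg_fun B (Neg (Neg B)) (eta B)) (Var 1)) (Var 0) \<Colon> Bot \<parallel> []" .
qed

text \<open>Both sides send x and k to k (F x).\<close>

lemma eta_natural:
  assumes F: "is_fun T F B A"
  shows "fun_eq T B (Neg (Neg A)) (comp_fun B (eta A) F) (comp_fun B (dneg_fun B A F) (eta B))"
proof (rule fun_eqI2)
  note nF = is_fun_neg[OF F] and nnF = is_fun_neg[OF is_fun_neg[OF F]]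
  show "is_fun T (comp_fun B (eta A) F) B (Neg (Neg A))"
    by (rule is_fun_comp[OF F is_fun_eta])
  show "is_fun T (comp_fun B (dneg_fun B A F) (eta B)) B (Neg (Neg A))"
    by (rule is_fun_comp[OF is_fun_eta nnF])
  have N: "T \<rhd> [Neg A, B] \<turnstile> Var 1 \<Colon> B \<parallel> []" and K: "T \<rhd> [Neg A, B] \<turnstile> Var 0 \<Colon> Neg A \<parallel> []"
    by (simp_all add: typed_VarI)
  note cong_App[OF comp_fun_App[OF F is_fun_eta N] eq_refl[OF K]]
  also note eta_App[OF typed_App_closed[OF F N] K]
  also note eq_sym[OF neg_fun_App[OF F K N]]
  also note eq_sym[OF eta_App[OF N typed_App_closed[OF nF K]]]
  also note eq_sym[OF neg_fun_App[OF nF typed_App_closed[OF is_fun_eta N] K]]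
  also note eq_sym[OF cong_App[OF comp_fun_App[OF is_fun_eta nnF N] eq_refl[OF K]]]
  finally show "T \<rhd> [Neg A, B] \<turnstile> App (App (comp_fun B (eta A) F) (Var 1)) (Var 0)
    \<approx> App (App (comp_fun B (dneg_fun B A F) (eta B)) (Var 1)) (Var 0) \<Colon> Bot \<parallel> []" .
qed

section \<open>Closure properties of focal functions\<close>

lemma focal_is_fun: "focal T F B A \<Longrightarrow> is_fun T F B A"
  by (simp add: focal_def)

text \<open>At negations \<open>eps\<close> is the negation of \<open>eta\<close>, so the required
  square is the naturality square of \<open>eta\<close> for \<open>F\<close>, turned around by
  negation.\<close>

lemma focal_neg:
  assumes F: "is_fun T F B A"
  shows "focal T (neg_fun B A F) (Neg A) (Neg B)"
proof (rule focalI)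
  note nF = is_fun_neg[OF F] and nnF = is_fun_neg[OF is_fun_neg[OF F]]
  show "is_fun T (neg_fun B A F) (Neg A) (Neg B)"
    by (rule nF)
  let ?V = "Var 0 :: ('t, 'c) trm"
  have V: "T \<rhd> [Neg (Neg (Neg A))] \<turnstile> ?V \<Colon> Neg (Neg (Neg A)) \<parallel> []"
    by (simp add: typed_VarI)
  note cong_App_closed[OF nF fun_eq_App[OF eps_Neg V]]
  also note eq_sym[OF neg_fun_comp_App[OF F is_fun_eta V]]
  also note fun_eq_App[OF neg_fun_cong[OF eta_natural[OF F]] V]
  also note neg_fun_comp_App[OF is_fun_eta nnF V]
  also note eq_sym[OF fun_eq_App[OF eps_Neg typed_App_closed[OF is_fun_neg[OF nnF] V]]]
  finally show "T \<rhd> [Neg (Neg (Neg A))] \<turnstile> App (neg_fun B A F) (App (eps (Neg A)) ?V)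
    \<approx> App (eps (Neg B)) (App (dneg_fun (Neg A) (Neg B) (neg_fun B A F)) ?V) \<Colon> Neg B \<parallel> []" .
qed

text \<open>With \<open>?k\<close> = \<lambda>x. a x, both sides become \<mu>a. V (...), containing
  \<open>eta\<close> at \<open>?k\<close> on the left and the negation of \<open>eps\<close> at
  \<open>?k\<close> on the right. These agree, since on m both give m \<open>?k\<close>: naming
  \<open>eps\<close> m by a contracts its \<mu>.\<close>

lemma focal_eps: "focal T (eps A) (Neg (Neg A)) A"
proof (rule focalI)
  let ?k = "Lam A (Name 0 (Var 0)) :: ('t, 'c) trm"
  let ?\<Gamma> = "[Neg (Neg A), Neg (Neg (Neg (Neg A)))]"
  show "is_fun T (eps A) (Neg (Neg A)) A"
    by (rule is_fun_eps)
  have V: "T \<rhd> [Neg (Neg (Neg (Neg A)))] \<turnstile> Var 0 \<Colon> Neg (Neg (Neg (Neg A))) \<parallel> \<Delta>" for \<Delta>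
    by (simp add: typed_VarI)
  have M: "T \<rhd> ?\<Gamma> \<turnstile> Var 0 \<Colon> Neg (Neg A) \<parallel> \<Delta>" for \<Delta>
    by (simp add: typed_VarI)
  have "T \<rhd> ?\<Gamma> \<turnstile> App ?k (App (eps A) (Var 0)) \<approx> Name 0 (App (eps A) (Var 0)) \<Colon> Bot \<parallel> [A]"
    by (intro beta_eq typed_NameI[where A = A] typed_VarI typed_App_closed[OF is_fun_eps] M) simp_all
  also have "T \<rhd> ?\<Gamma> \<turnstile> Name 0 (App (eps A) (Var 0)) \<approx> Name 0 (Mu A (App (Var 0) ?k)) \<Colon> Bot \<parallel> [A]"
    using eps_App[OF M] by (intro cong_NameI[where A = A]) simp_all
  also have "T \<rhd> ?\<Gamma> \<turnstile> Name 0 (Mu A (App (Var 0) ?k)) \<approx> App (Var 0) ?k \<Colon> Bot \<parallel> [A]"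
    using eq_Name_MuI[OF _ _ typed_App[OF M typed_Lam_Name[of T _ A "[A]"]], of 0] by simp
  also note eq_sym[OF eta_App[OF typed_Lam_Name M]]
  finally have *: "T \<rhd> ?\<Gamma> \<turnstile> App ?k (App (eps A) (Var 0)) \<approx> App (App (eta (Neg A)) ?k) (Var 0) \<Colon> Bot \<parallel> [A]" .
  have "T \<rhd> ?\<Gamma> \<turnstile> App (App (neg_fun (Neg (Neg A)) A (eps A)) ?k) (Var 0)
      \<approx> App (App (eta (Neg A)) ?k) (Var 0) \<Colon> Bot \<parallel> [A]"
    using eq_trans[OF neg_fun_App[OF is_fun_eps typed_Lam_Name M] *] .
  note Lam_eq = cong_Lam[OF this]
  \<comment> \<open>Eta expansion, stated here because \<open>?k\<close> contains the free control
    variable a and the closed extensionality lemmas do not apply.\<close>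
  have ext: "T \<rhd> [Neg (Neg (Neg (Neg A)))] \<turnstile> Lam (Neg (Neg A)) (App (App F ?k) (Var 0)) \<approx> App F ?k
      \<Colon> Neg (Neg (Neg A)) \<parallel> [A]" if F: "is_fun T F (Neg A) (Neg (Neg (Neg A)))" for F
    using eq_eta[OF typed_App_closed[OF F typed_Lam_Name[of T _ A "[]"]]]
    by (simp add: closed_simps[OF F])
  note eq_sym[OF ext[OF is_fun_eta]]
  also note eq_sym[OF Lam_eq]
  also note ext[OF is_fun_neg[OF is_fun_eps]]
  finally have eta_k: "T \<rhd> [Neg (Neg (Neg (Neg A)))] \<turnstile> App (eta (Neg A)) ?k
    \<approx> App (neg_fun (Neg (Neg A)) A (eps A)) ?k \<Colon> Neg (Neg (Neg A)) \<parallel> [A]" .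
  note cong_App_closed[OF is_fun_eps fun_eq_App[OF eps_Neg V]]
  also note eps_neg_App[OF is_fun_eta V, simplified]
  also note cong_Mu[OF cong_App[OF eq_refl[OF V] eta_k]]
  also note eq_sym[OF eps_neg_App[OF is_fun_neg[OF is_fun_eps] V, simplified]]
  finally show "T \<rhd> [Neg (Neg (Neg (Neg A)))] \<turnstile> App (eps A) (App (eps (Neg (Neg A))) (Var 0))
    \<approx> App (eps A) (App (dneg_fun (Neg (Neg A)) A (eps A)) (Var 0)) \<Colon> A \<parallel> []" .
qed

lemma dneg_fun_comp_App:
  assumes F: "is_fun T F A B" and G: "is_fun T G B D" and N: "T \<rhd> \<Gamma> \<turnstile> N \<Colon> Neg (Neg A) \<parallel> \<Delta>"
  shows "T \<rhd> \<Gamma> \<turnstile> App (dneg_fun A D (comp_fun A G F)) N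
    \<approx> App (dneg_fun B D G) (App (dneg_fun A B F) N) \<Colon> Neg (Neg D) \<parallel> \<Delta>"
  by (rule eq_trans[OF fun_eq_App[OF neg_fun_cong[OF neg_fun_comp[OF F G]] N]
      neg_fun_comp_App[OF is_fun_neg[OF G] is_fun_neg[OF F] N]])

text \<open>The naturality squares of \<open>F\<close> and \<open>G\<close> are pasted
  together.\<close>

lemma focal_comp:
  assumes F: "focal T F A B" and G: "focal T G B D"
  shows "focal T (comp_fun A G F) A D"
proof (rule focalI)
  note fF = focal_is_fun[OF F] and fG = focal_is_fun[OF G]
  show "is_fun T (comp_fun A G F) A D"
    by (rule is_fun_comp[OF fF fG])
  let ?V = "Var 0 :: ('t, 'c) trm"
  have V: "T \<rhd> [Neg (Neg A)] \<turnstile> ?V \<Colon> Neg (Neg A) \<parallel> []"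
    by (simp add: typed_VarI)
  note comp_fun_App[OF fF fG typed_App_closed[OF is_fun_eps V]]
  also note cong_App_closed[OF fG focal_natural[OF F V]]
  also note focal_natural[OF G typed_App_closed[OF is_fun_neg[OF is_fun_neg[OF fF]] V]]
  also note eq_sym[OF cong_App_closed[OF is_fun_eps dneg_fun_comp_App[OF fF fG V]]]
  finally show "T \<rhd> [Neg (Neg A)] \<turnstile> App (comp_fun A G F) (App (eps A) ?V)
    \<approx> App (eps D) (App (dneg_fun A D (comp_fun A G F)) ?V) \<Colon> D \<parallel> []" .
qed

lemma fun_eq_id_App:
  assumes F: "is_fun T F A B" and G: "is_fun T G B A"
    and eq: "fun_eq T A A (comp_fun A G F) (id_fun A)" and N: "T \<rhd> \<Gamma> \<turnstile> N \<Colon> A \<parallel> \<Delta>"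
  shows "T \<rhd> \<Gamma> \<turnstile> App G (App F N) \<approx> N \<Colon> A \<parallel> \<Delta>"
proof -
  note eq_sym[OF comp_fun_App[OF F G N]]
  also note fun_eq_App[OF eq N]
  also note id_fun_App[OF N]
  finally show ?thesis .
qed

text \<open>Insert \<not>\<not>F after \<not>\<not>G, which is the identity, slide \<open>F\<close>
  out past \<open>eps\<close> by its naturality, and cancel it against \<open>G\<close>.\<close>

lemma focal_inverse:
  assumes F: "focal T F A B" and G: "is_fun T G B A"
    and GF: "fun_eq T A A (comp_fun A G F) (id_fun A)"
    and FG: "fun_eq T B B (comp_fun B F G) (id_fun B)"
  shows "focal T G B A"
proof (rule focalI)
  note fF = focal_is_fun[OF F]
  note nnF = is_fun_neg[OF is_fun_neg[OF fF]] and nnG = is_fun_neg[OF is_fun_neg[OF G]]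
  show "is_fun T G B A" by (rule G)
  let ?V = "Var 0 :: ('t, 'c) trm"
  have V: "T \<rhd> [Neg (Neg B)] \<turnstile> ?V \<Colon> Neg (Neg B) \<parallel> []"
    by (simp add: typed_VarI)
  note V' = typed_App_closed[OF nnG V]
  note eq_sym[OF dneg_fun_comp_App[OF G fF V]]
  also note fun_eq_App[OF neg_fun_cong[OF neg_fun_cong[OF FG]] V]
  also note fun_eq_App[OF neg_fun_cong[OF neg_fun_id] V]
  also note fun_eq_App[OF neg_fun_id V]
  also note id_fun_App[OF V]
  finally have dFG: "T \<rhd> [Neg (Neg B)] \<turnstile> App (dneg_fun A B F) (App (dneg_fun B A G) ?V) \<approx> ?V
    \<Colon> Neg (Neg B) \<parallel> []" .
  note eq_sym[OF cong_App_closed[OF G cong_App_closed[OF is_fun_eps dFG]]]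
  also note eq_sym[OF cong_App_closed[OF G focal_natural[OF F V']]]
  also note fun_eq_id_App[OF fF G GF typed_App_closed[OF is_fun_eps V']]
  finally show "T \<rhd> [Neg (Neg B)] \<turnstile> App G (App (eps B) ?V)
    \<approx> App (eps A) (App (dneg_fun B A G) ?V) \<Colon> A \<parallel> []" .
qed

section \<open>Transposes of functions out of negations\<close>

text \<open>\<open>transpose_fun Y A F\<close> is \<open>\<lambda>k. \<mu>y. k (F (\<lambda>z. y z))\<close> for \<open>F : \<not>Y \<rightarrow> A\<close>.\<close>

definition transpose_fun :: "'t ty \<Rightarrow> 't ty \<Rightarrow> ('t, 'c) trm \<Rightarrow> ('t, 'c) trm" where
  "transpose_fun Y A F = comp_fun (Neg A) (eps Y) (neg_fun (Neg Y) A F)"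

lemma focal_transpose: "is_fun T F (Neg Y) A \<Longrightarrow> focal T (transpose_fun Y A F) (Neg A) Y"
  unfolding transpose_fun_def by (intro focal_comp[OF focal_neg focal_eps])

lemma is_fun_transpose: "is_fun T F (Neg Y) A \<Longrightarrow> is_fun T (transpose_fun Y A F) (Neg A) Y"
  by (rule focal_is_fun[OF focal_transpose])

lemma transpose_fun_App:
  assumes F: "is_fun T F (Neg Y) A" and N: "T \<rhd> \<Gamma> \<turnstile> N \<Colon> Neg A \<parallel> \<Delta>"
  shows "T \<rhd> \<Gamma> \<turnstile> App (transpose_fun Y A F) N \<approx> App (eps Y) (App (neg_fun (Neg Y) A F) N) \<Colon> Y \<parallel> \<Delta>"
  unfolding transpose_fun_def by (rule comp_fun_App[OF is_fun_neg[OF F] is_fun_eps N])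

lemma transpose_fun_cong:
  assumes eq: "fun_eq T (Neg Y) A F G" and N: "T \<rhd> \<Gamma> \<turnstile> N \<Colon> Neg A \<parallel> \<Delta>"
  shows "T \<rhd> \<Gamma> \<turnstile> App (transpose_fun Y A F) N \<approx> App (transpose_fun Y A G) N \<Colon> Y \<parallel> \<Delta>"
proof -
  note transpose_fun_App[OF fun_eq_is_fun(1)[OF eq] N]
  also note cong_App_closed[OF is_fun_eps fun_eq_App[OF neg_fun_cong[OF eq] N]]
  also note eq_sym[OF transpose_fun_App[OF fun_eq_is_fun(2)[OF eq] N]]
  finally show ?thesis .
qed

text \<open>Naturality of \<open>eps\<close> at the focal \<open>X\<close> moves \<open>X\<close>
  inside as a double negation, which contravariance then absorbs into the negated function.\<close>

lemma focal_transpose_App: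
  assumes X: "focal T X Y Z" and F: "is_fun T F (Neg Y) A" and N: "T \<rhd> \<Gamma> \<turnstile> N \<Colon> Neg A \<parallel> \<Delta>"
  shows "T \<rhd> \<Gamma> \<turnstile> App X (App (transpose_fun Y A F) N)
    \<approx> App (transpose_fun Z A (comp_fun (Neg Z) F (neg_fun Y Z X))) N \<Colon> Z \<parallel> \<Delta>"
proof -
  note fX = focal_is_fun[OF X]
  note nX = is_fun_neg[OF fX]
  note cong_App_closed[OF fX transpose_fun_App[OF F N]]
  also note focal_natural[OF X typed_App_closed[OF is_fun_neg[OF F] N]]
  also note eq_sym[OF cong_App_closed[OF is_fun_eps neg_fun_comp_App[OF nX F N]]]
  also note eq_sym[OF transpose_fun_App[OF is_fun_comp[OF nX F] N]]
  finally show ?thesis .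
qed

text \<open>Naturality of \<open>eps\<close> at the focal \<open>F\<close> leaves F applied to a
  composite of \<open>eps\<close> at \<not>Y with the negation of \<open>eps\<close> at Y. That
  composite is the negation of \<open>eps\<close> after \<open>eta\<close>, hence the
  identity.\<close>

lemma eps_neg_transpose:
  assumes F: "focal T F (Neg Y) A" and N: "T \<rhd> \<Gamma> \<turnstile> N \<Colon> Neg Y \<parallel> \<Delta>"
  shows "T \<rhd> \<Gamma> \<turnstile> App (eps A) (App (neg_fun (Neg A) Y (transpose_fun Y A F)) N) \<approx> App F N \<Colon> A \<parallel> \<Delta>"
proof -
  note fF = focal_is_fun[OF F]
  have V: "T \<rhd> [Y] \<turnstile> Var 0 \<Colon> Y \<parallel> []"
    by (simp add: typed_VarI)
  have eq_id: "fun_eq T Y Y (comp_fun Y (eps Y) (eta Y)) (id_fun Y)"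
    by (intro fun_eqI is_fun_comp[OF is_fun_eta is_fun_eps] is_fun_id
        eq_trans[OF comp_fun_App[OF is_fun_eta is_fun_eps V]
          eq_trans[OF eps_eta[OF V] eq_sym[OF id_fun_App[OF V]]]])
  note N' = typed_App_closed[OF is_fun_neg[OF is_fun_eps] N]
  note fun_eq_App[OF eps_Neg N']
  also note eq_sym[OF neg_fun_comp_App[OF is_fun_eta is_fun_eps N]]
  also note fun_eq_App[OF neg_fun_cong[OF eq_id] N]
  also note fun_eq_App[OF neg_fun_id N]
  also note id_fun_App[OF N]
  finally have triangle: "T \<rhd> \<Gamma> \<turnstile> App (eps (Neg Y)) (App (neg_fun (Neg (Neg Y)) Y (eps Y)) N) \<approx> N
    \<Colon> Neg Y \<parallel> \<Delta>" .
  note cong_App_closed[OF is_fun_eps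
      neg_fun_comp_App[OF is_fun_neg[OF fF] is_fun_eps N, folded transpose_fun_def]]
  also note eq_sym[OF focal_natural[OF F N']]
  also note cong_App_closed[OF fF triangle]
  finally show ?thesis .
qed

section \<open>Initiality\<close>

context
  fixes Fo Go :: "'t ty \<Rightarrow> 't ty"
    and Fm Gm :: "('t, 'c) trm \<Rightarrow> ('t, 'c) trm"
    and \<phi> \<psi> :: "'t ty \<Rightarrow> ('t, 'c) trm"
    and C :: "'t ty" and X :: "('t, 'c) trm"
  assumes Fm: "focus_functor T Fo Fm"
    and Gm: "lm_functor T Go Gm"
    and iso: "dual_natural_iso T Go Gm Fo Fm \<phi> \<psi>"
    and final: "final_coalgebra T Go Gm C X"
    and X: "focal T X C (Go C)"
begin

lemma focal_Fm: "focal T F A B \<Longrightarrow> focal T (Fm F) (Fo A) (Fo B)"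
  using Fm unfolding focus_functor_def by blast

lemma Fm_cong:
  "focal T F A B \<Longrightarrow> focal T G A B \<Longrightarrow> fun_eq T A B F G \<Longrightarrow> fun_eq T (Fo A) (Fo B) (Fm F) (Fm G)"
  using Fm unfolding focus_functor_def by blast

lemma Fm_comp:
  "focal T F A B \<Longrightarrow> focal T G B D \<Longrightarrow>
    fun_eq T (Fo A) (Fo D) (Fm (comp_fun A G F)) (comp_fun (Fo A) (Fm G) (Fm F))"
  using Fm unfolding focus_functor_def by blast

lemma is_fun_Gm: "is_fun T F A B \<Longrightarrow> is_fun T (Gm F) (Go A) (Go B)"
  using Gm unfolding lm_functor_def by blast

lemma focal_Gm: "focal T F A B \<Longrightarrow> focal T (Gm F) (Go A) (Go B)"
  using Gm unfolding lm_functor_def by blast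

lemma focal_phi: "focal T (\<phi> A) (Neg (Go A)) (Fo (Neg A))"
  using iso unfolding dual_natural_iso_def by blast

text \<open>Focality of \<phi> passes to its two-sided inverse by
  \<open>focal_inverse\<close>.\<close>

lemma focal_psi: "focal T (\<psi> A) (Fo (Neg A)) (Neg (Go A))"
  using iso unfolding dual_natural_iso_def by (blast intro: focal_inverse)

lemma psi_phi: "T \<rhd> \<Gamma> \<turnstile> N \<Colon> Neg (Go A) \<parallel> \<Delta> \<Longrightarrow> T \<rhd> \<Gamma> \<turnstile> App (\<psi> A) (App (\<phi> A) N) \<approx> N \<Colon> Neg (Go A) \<parallel> \<Delta>"
  using iso unfolding dual_natural_iso_def
  by (intro fun_eq_id_App[OF focal_is_fun[OF focal_phi] focal_is_fun[OF focal_psi]]) blast+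

lemma phi_psi: "T \<rhd> \<Gamma> \<turnstile> N \<Colon> Fo (Neg A) \<parallel> \<Delta> \<Longrightarrow> T \<rhd> \<Gamma> \<turnstile> App (\<phi> A) (App (\<psi> A) N) \<approx> N \<Colon> Fo (Neg A) \<parallel> \<Delta>"
  using iso unfolding dual_natural_iso_def
  by (intro fun_eq_id_App[OF focal_is_fun[OF focal_psi] focal_is_fun[OF focal_phi]]) blast+

lemma phi_natural:
  assumes F: "is_fun T F A B" and N: "T \<rhd> \<Gamma> \<turnstile> N \<Colon> Neg (Go B) \<parallel> \<Delta>"
  shows "T \<rhd> \<Gamma> \<turnstile> App (\<phi> A) (App (neg_fun (Go A) (Go B) (Gm F)) N)
    \<approx> App (Fm (neg_fun A B F)) (App (\<phi> B) N) \<Colon> Fo (Neg A) \<parallel> \<Delta>"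
proof -
  have eq: "fun_eq T (Neg (Go B)) (Fo (Neg A))
      (comp_fun (Neg (Go B)) (\<phi> A) (neg_fun (Go A) (Go B) (Gm F)))
      (comp_fun (Neg (Go B)) (Fm (neg_fun A B F)) (\<phi> B))"
    using iso F unfolding dual_natural_iso_def by blast
  note eq_sym[OF comp_fun_App[OF is_fun_neg[OF is_fun_Gm[OF F]] focal_is_fun[OF focal_phi] N]]
  also note fun_eq_App[OF eq N]
  also note comp_fun_App[OF focal_is_fun[OF focal_phi] focal_is_fun[OF focal_Fm[OF focal_neg[OF F]]] N]
  finally show ?thesis .
qed

text \<open>Precomposition with \<open>Fm (eps A)\<close> and \<phi> gives the algebra a negation as
  its source, so that it has a transpose.\<close>

definition algebra_dual :: "'t ty \<Rightarrow> ('t, 'c) trm \<Rightarrow> ('t, 'c) trm" where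
  "algebra_dual A F =
    comp_fun (Neg (Go (Neg A))) (comp_fun (Fo (Neg (Neg A))) F (Fm (eps A))) (\<phi> (Neg A))"

lemma focal_algebra_dual: "focal T F (Fo A) A \<Longrightarrow> focal T (algebra_dual A F) (Neg (Go (Neg A))) A"
  unfolding algebra_dual_def by (rule focal_comp[OF focal_phi focal_comp[OF focal_Fm[OF focal_eps]]])

text \<open>The bridge between coalgebras and algebras: naturality of \<phi> turns the negated
  \<open>Gm H\<close> into \<open>Fm\<close> of the negated \<open>H\<close>, and functoriality
  merges this with \<open>Fm (eps A)\<close>. Existence and uniqueness both use it.\<close>

lemma algebra_dual_neg_Gm:
  assumes F: "focal T F (Fo A) A" and H: "is_fun T H (Neg A) C" and N: "T \<rhd> \<Gamma> \<turnstile> N \<Colon> Neg (Go C) \<parallel> \<Delta>"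
  shows "T \<rhd> \<Gamma> \<turnstile> App (algebra_dual A F) (App (neg_fun (Go (Neg A)) (Go C) (Gm H)) N)
    \<approx> App F (App (Fm (comp_fun (Neg C) (eps A) (neg_fun (Neg A) C H))) (App (\<phi> C) N)) \<Colon> A \<parallel> \<Delta>"
proof -
  note fF = focal_is_fun[OF F] and fe = focal_is_fun[OF focal_Fm[OF focal_eps]]
    and fp = focal_is_fun[OF focal_phi] and fn = focal_is_fun[OF focal_Fm[OF focal_neg[OF H]]]
  note N' = typed_App_closed[OF is_fun_neg[OF is_fun_Gm[OF H]] N]
  note N'' = typed_App_closed[OF fp N]
  note comp_fun_App[OF fp is_fun_comp[OF fe fF] N', folded algebra_dual_def]
  also note comp_fun_App[OF fe fF typed_App_closed[OF fp N']]
  also note cong_App_closed[OF fF cong_App_closed[OF fe phi_natural[OF H N]]]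
  also note eq_sym[OF cong_App_closed[OF fF comp_fun_App[OF fn fe N'']]]
  also note eq_sym[OF cong_App_closed[OF fF fun_eq_App[OF Fm_comp[OF focal_neg[OF H] focal_eps] N'']]]
  finally show ?thesis .
qed

lemma neg_final_focally_initial:
  "focally_initial_algebra T Fo Fm (Neg C) (comp_fun (Fo (Neg C)) (neg_fun C (Go C) X) (\<psi> C))"
  unfolding focally_initial_algebra_def
proof (intro conjI allI impI)
  let ?X = "comp_fun (Fo (Neg C)) (neg_fun C (Go C) X) (\<psi> C)"
  note fX = focal_is_fun[OF X] and fpsi = focal_is_fun[OF focal_psi[of C]]
  note nX = is_fun_neg[OF fX]
  show foc: "focal T ?X (Fo (Neg C)) (Neg C)"
    by (rule focal_comp[OF focal_psi focal_neg[OF fX]])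
  fix A F
  assume F: "focal T F (Fo A) A"
  note fF = focal_is_fun[OF F]
  let ?f = "algebra_dual A F"
  \<comment> \<open>The coalgebra on \<not>A to which finality is applied.\<close>
  let ?g = "transpose_fun (Go (Neg A)) A ?f"
  note f = focal_algebra_dual[OF F]
  note ff = focal_is_fun[OF f]
  note g = is_fun_transpose[OF ff]
  obtain H where H: "is_fun T H (Neg A) C"
    and H_hom: "fun_eq T (Neg A) (Go C) (comp_fun (Neg A) X H) (comp_fun (Neg A) (Gm H) ?g)"
    and H_unique: "\<And>H'. is_fun T H' (Neg A) C \<Longrightarrow>
      fun_eq T (Neg A) (Go C) (comp_fun (Neg A) X H') (comp_fun (Neg A) (Gm H') ?g) \<Longrightarrow>
      fun_eq T (Neg A) C H' H"
    using final g unfolding final_coalgebra_def by metis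
  \<comment> \<open>This witness is focal even if \<open>H\<close> is not, since negated functions
    and \<open>eps\<close> always are.\<close>
  let ?H = "comp_fun (Neg C) (eps A) (neg_fun (Neg A) C H)"
  note nH = is_fun_neg[OF H]
  note fG = is_fun_Gm[OF H]
  have fH: "focal T ?H (Neg C) A"
    by (rule focal_comp[OF focal_neg[OF H] focal_eps])
  show "\<exists>H. focal T H (Neg C) A \<and>
      fun_eq T (Fo (Neg C)) A (comp_fun (Fo (Neg C)) H ?X) (comp_fun (Fo (Neg C)) F (Fm H)) \<and>
      (\<forall>H'. focal T H' (Neg C) A \<longrightarrow>
        fun_eq T (Fo (Neg C)) A (comp_fun (Fo (Neg C)) H' ?X) (comp_fun (Fo (Neg C)) F (Fm H')) \<longrightarrow>
        fun_eq T (Neg C) A H' H)"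
  proof (intro exI[of _ ?H] conjI allI impI)
    show "focal T ?H (Neg C) A" by (rule fH)
    note fFm = focal_is_fun[OF focal_Fm[OF fH]]
    show "fun_eq T (Fo (Neg C)) A (comp_fun (Fo (Neg C)) ?H ?X) (comp_fun (Fo (Neg C)) F (Fm ?H))"
    proof (rule fun_eqI)
      show "is_fun T (comp_fun (Fo (Neg C)) ?H ?X) (Fo (Neg C)) A"
        by (rule is_fun_comp[OF focal_is_fun[OF foc] focal_is_fun[OF fH]])
      show "is_fun T (comp_fun (Fo (Neg C)) F (Fm ?H)) (Fo (Neg C)) A"
        by (rule is_fun_comp[OF fFm fF])
      let ?V = "Var 0 :: ('t, 'c) trm"
      have V: "T \<rhd> [Fo (Neg C)] \<turnstile> ?V \<Colon> Fo (Neg C) \<parallel> []"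
        by (simp add: typed_VarI)
      note P = typed_App_closed[OF fpsi V]
      note comp_fun_App[OF focal_is_fun[OF foc] focal_is_fun[OF fH] V]
      also note cong_App_closed[OF focal_is_fun[OF fH] comp_fun_App[OF fpsi nX V]]
      also note comp_fun_App[OF nH is_fun_eps typed_App_closed[OF nX P]]
      also note eq_sym[OF cong_App_closed[OF is_fun_eps neg_fun_comp_App[OF H fX P]]]
      \<comment> \<open>The coalgebra equation for \<open>H\<close> enters in negated form.\<close>
      also note cong_App_closed[OF is_fun_eps fun_eq_App[OF neg_fun_cong[OF H_hom] P]]
      also note cong_App_closed[OF is_fun_eps neg_fun_comp_App[OF g fG P]]
      \<comment> \<open>Negation followed by \<open>eps\<close> undoes the transpose, returning from
        \<open>?g\<close> to \<open>?f\<close>.\<close>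
      also note eps_neg_transpose[OF f typed_App_closed[OF is_fun_neg[OF fG] P]]
      also note algebra_dual_neg_Gm[OF F H P]
      also note cong_App_closed[OF fF cong_App_closed[OF fFm phi_psi[OF V]]]
      also note eq_sym[OF comp_fun_App[OF fFm fF V]]
      finally show "T \<rhd> [Fo (Neg C)] \<turnstile> App (comp_fun (Fo (Neg C)) ?H ?X) ?V
        \<approx> App (comp_fun (Fo (Neg C)) F (Fm ?H)) ?V \<Colon> A \<parallel> []" .
    qed
    fix H'
    assume H': "focal T H' (Neg C) A"
      and hom: "fun_eq T (Fo (Neg C)) A (comp_fun (Fo (Neg C)) H' ?X) (comp_fun (Fo (Neg C)) F (Fm H'))"
    note fH' = focal_is_fun[OF H'] and fFm' = focal_is_fun[OF focal_Fm[OF H']]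
    \<comment> \<open>The transpose of a competing algebra morphism, to be recognised as a coalgebra
      morphism from \<open>?g\<close> to \<open>X\<close>.\<close>
    let ?h = "transpose_fun C A H'"
    \<comment> \<open>Equal to \<open>H'\<close> by \<open>eh_eq\<close>, but in the form that
      \<open>algebra_dual_neg_Gm\<close> produces under \<open>Fm\<close>.\<close>
    let ?eh = "comp_fun (Neg C) (eps A) (neg_fun (Neg A) C ?h)"
    note h = is_fun_transpose[OF fH']
    \<comment> \<open>Transposes are focal and \<open>Gm\<close> preserves focality; this lets
      \<open>Gm ?h\<close> be absorbed into a transpose below.\<close>
    note Gh = focal_Gm[OF focal_transpose[OF fH']]
    have eh: "focal T ?eh (Neg C) A"
      by (rule focal_comp[OF focal_neg[OF h] focal_eps])
    have eh_eq: "fun_eq T (Neg C) A ?eh H'"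
    proof (rule fun_eqI[OF focal_is_fun[OF eh] fH'])
      have V: "T \<rhd> [Neg C] \<turnstile> Var 0 \<Colon> Neg C \<parallel> []"
        by (simp add: typed_VarI)
      show "T \<rhd> [Neg C] \<turnstile> App ?eh (Var 0) \<approx> App H' (Var 0) \<Colon> A \<parallel> []"
        by (rule eq_trans[OF comp_fun_App[OF is_fun_neg[OF h] is_fun_eps V] eps_neg_transpose[OF H' V]])
    qed
    have dual_hom: "fun_eq T (Neg (Go C)) A (comp_fun (Neg (Go C)) H' (neg_fun C (Go C) X))
      (comp_fun (Neg (Go C)) ?f (neg_fun (Go (Neg A)) (Go C) (Gm ?h)))"
    proof (rule fun_eqI)
      note fGh = focal_is_fun[OF Gh]
      note nGh = is_fun_neg[OF fGh]
      show "is_fun T (comp_fun (Neg (Go C)) H' (neg_fun C (Go C) X)) (Neg (Go C)) A"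
        by (rule is_fun_comp[OF nX fH'])
      show "is_fun T (comp_fun (Neg (Go C)) ?f (neg_fun (Go (Neg A)) (Go C) (Gm ?h))) (Neg (Go C)) A"
        by (rule is_fun_comp[OF nGh ff])
      let ?V = "Var 0 :: ('t, 'c) trm"
      have V: "T \<rhd> [Neg (Go C)] \<turnstile> ?V \<Colon> Neg (Go C) \<parallel> []"
        by (simp add: typed_VarI)
      note P = typed_App_closed[OF focal_is_fun[OF focal_phi] V]
      note comp_fun_App[OF nX fH' V]
      \<comment> \<open>Inserting \<psi> after \<phi> makes the algebra structure \<open>?X\<close>
        appear, so that \<open>hom\<close> applies.\<close>
      also note eq_sym[OF cong_App_closed[OF fH' cong_App_closed[OF nX psi_phi[OF V]]]]
      also note eq_sym[OF cong_App_closed[OF fH' comp_fun_App[OF fpsi nX P]]]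
      also note eq_sym[OF comp_fun_App[OF focal_is_fun[OF foc] fH' P]]
      also note fun_eq_App[OF hom P]
      also note comp_fun_App[OF fFm' fF P]
      also note eq_sym[OF cong_App_closed[OF fF fun_eq_App[OF Fm_cong[OF eh H' eh_eq] P]]]
      also note eq_sym[OF algebra_dual_neg_Gm[OF F h V]]
      also note eq_sym[OF comp_fun_App[OF nGh ff V]]
      finally show "T \<rhd> [Neg (Go C)] \<turnstile> App (comp_fun (Neg (Go C)) H' (neg_fun C (Go C) X)) ?V
        \<approx> App (comp_fun (Neg (Go C)) ?f (neg_fun (Go (Neg A)) (Go C) (Gm ?h))) ?V \<Colon> A \<parallel> []" .
    qed
    \<comment> \<open>This is the transpose of \<open>dual_hom\<close>: focality of \<open>X\<close>
      handles the left side and focality of \<open>Gm ?h\<close> the right.\<close>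
    have "fun_eq T (Neg A) (Go C) (comp_fun (Neg A) X ?h) (comp_fun (Neg A) (Gm ?h) ?g)"
    proof (rule fun_eqI)
      show "is_fun T (comp_fun (Neg A) X ?h) (Neg A) (Go C)"
        by (rule is_fun_comp[OF h fX])
      show "is_fun T (comp_fun (Neg A) (Gm ?h) ?g) (Neg A) (Go C)"
        by (rule is_fun_comp[OF g focal_is_fun[OF Gh]])
      let ?V = "Var 0 :: ('t, 'c) trm"
      have V: "T \<rhd> [Neg A] \<turnstile> ?V \<Colon> Neg A \<parallel> []"
        by (simp add: typed_VarI)
      note comp_fun_App[OF h fX V]
      also note focal_transpose_App[OF X fH' V]
      also note transpose_fun_cong[OF dual_hom V]
      also note eq_sym[OF focal_transpose_App[OF Gh ff V]]
      also note eq_sym[OF comp_fun_App[OF g focal_is_fun[OF Gh] V]]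
      finally show "T \<rhd> [Neg A] \<turnstile> App (comp_fun (Neg A) X ?h) ?V
        \<approx> App (comp_fun (Neg A) (Gm ?h) ?g) ?V \<Colon> Go C \<parallel> []" .
    qed
    then have h_eq: "fun_eq T (Neg A) C ?h H"
      by (rule H_unique[OF h])
    show "fun_eq T (Neg C) A H' ?H"
    proof (rule fun_eqI[OF fH' focal_is_fun[OF fH]])
      let ?V = "Var 0 :: ('t, 'c) trm"
      have V: "T \<rhd> [Neg C] \<turnstile> ?V \<Colon> Neg C \<parallel> []"
        by (simp add: typed_VarI)
      \<comment> \<open>\<open>H'\<close> is recovered from its transpose, which uniqueness has
        identified with \<open>H\<close>.\<close>
      note eq_sym[OF eps_neg_transpose[OF H' V]]
      also note cong_App_closed[OF is_fun_eps fun_eq_App[OF neg_fun_cong[OF h_eq] V]]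
      also note eq_sym[OF comp_fun_App[OF nH is_fun_eps V]]
      finally show "T \<rhd> [Neg C] \<turnstile> App H' ?V \<approx> App ?H ?V \<Colon> A \<parallel> []" .
    qed
  qed
qed

end

end

theorem theorem1:
  fixes T :: "('t, 'c) lmtheory"
    and Fo Go :: "'t ty \<Rightarrow> 't ty"
    and Fm Gm :: "('t, 'c) trm \<Rightarrow> ('t, 'c) trm"
    and \<phi> \<psi> :: "'t ty \<Rightarrow> ('t, 'c) trm"
    and C :: "'t ty"
    and X :: "('t, 'c) trm"
  assumes "lambda_mu_theory T"
    and "focus_functor T Fo Fm"
    and "lm_functor T Go Gm"
    and "dual_natural_iso T Go Gm Fo Fm \<phi> \<psi>"
    and "final_coalgebra T Go Gm C X"
    and "focal T X C (Go C)"
  shows "focally_initial_algebra T Fo Fm (Neg C)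
           (comp_fun (Fo (Neg C)) (neg_fun C (Go C) X) (\<psi> C))"
  using assms by (rule neg_final_focally_initial)

end
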